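(* (a) For any content space $\mathcal C$, the Gleason map $p_{\mathcal C}$ is an integration space morphism from $\Xi(\mathcal C^* )$ to $\Upsilon(\widehat{\mathcal C})$. (b) The collection $\{p_{\mathcal C}:\mathcal C\in\mathbf{Cont}\}$ is a natural transformation from the functor $\Xi\circ\sigma$ to the functor $\Upsilon\circ\beta$ (both from $\mathbf{Cont}$ to $\mathbf{CmpInt}$); that is, for every content space morphism $\phi$ from $\mathcal C_1$ to $\mathcal C_2$, $\widehat\phi\circ p_{\mathcal C_1}=p_{\mathcal C_2}\circ\phi^*$.
   Context: For a topological space $\mathcal T$, an open set $R\subseteq\mathcal T$ is regular if $R=\mathrm{int}(\mathrm{clos}(R))$. $\mathfrak R(\mathcal T)$ is the set of regular open subsets; it is a Boolean algebra with meet $\cap$, join $Q\vee R:=\mathrm{int}(\mathrm{clos}(Q\cup R))$ and complement $\neg R:=\mathrm{int}(\mathcal T\setminus R)$. A Boolean subalgebra is a subset closed under $\cap,\vee,\neg$. A content on $\mathfrak B\subseteq\mathfrak R(\mathcal S)$ is a function $\mu:\mathfrak B\to[0,\infty)$ such that $\mu[B_1\vee\cdots\vee B_N]=\sum_n\mu[B_n]$ for every finite collection of disjoint elements of $\mathfrak B$. For $\mathcal S$ locally compact Hausdorff with Stone-Čech compactification $\widehat{\mathcal S}$, each $R\in\mathfrak R(\mathcal S)$ has a unique $\widehat R\in\mathfrak R(\widehat{\mathcal S})$ with $\widehat R\cap\mathcal S=R$. Put $\widehat{\mathfrak B}:=\{\widehat B: B\in\mathfrak B\}$. $\mathfrak B$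 is generative if $\widehat{\mathfrak B}$ is a base for the topology of $\widehat{\mathcal S}$. Content spaces: a content space is a triple $\mathcal C=(\mathcal S,\mathfrak B,\mu)$ where $\mathcal S$ is locally compact Hausdorff, $\mathfrak B$ is a generative Boolean subalgebra of $\mathfrak R(\mathcal S)$, and $\mu$ is a content on $\mathfrak B$ with $\mu[\mathcal S]=1$. A morphism from $(\mathcal S_1,\mathfrak B_1,\mu_1)$ to $(\mathcal S_2,\mathfrak B_2,\mu_2)$ is a continuous $\phi:\mathcal S_1\to\mathcal S_2$ such that $B\mapsto\phi^{-1}(B)$ is a Boolean algebra homomorphism $\mathfrak B_2\to\mathfrak B_1$ and $\mu_1[\phi^{-1}(B)]=\mu_2[B]$ for all $B\in\mathfrak B_2$. $\mathbf{Cont}$ is the category of content spaces. The functor $\beta$: $\beta(\mathcal C)=\widehat{\mathcal C}:=(\widehat{\mathcal S},\widehat{\mathfrak B},\widehat\mu)$ with $\widehat\mu[\widehat B]:=\mu[B]$, and $\beta(\phi)=\widehat\phi:\widehat{\mathcal S}_1\to\widehat{\mathcal S}_2$ is the unique continuous extension of $\phi$. The functor $\sigma$: $\sigma(\mathcal C)=\mathcal C^*:=(\mathcal S^*,\mu^* )$, where $\mathcal S^*$ is the Stone space of $\mathfrak B$ (ultrafilters of $\mathfrak B$, with base of clopen sets $B^*:=\{s^*: B\in s^*\}$), and $\mu^*$ is the unique normal (closed-inner-regular and open-outer-regular) Borel probability measure on $\mathcal S^*$ with $\mu^*[B^*]=\mu[B]$ for all $B\in\mathfrak B$; and $\sigma(\phi)=\phi^*:\mathcal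 S_1^*\to\mathcal S_2^*$, $\phi^*(s^*_1):=\{B\in\mathfrak B_2:\phi^{-1}(B)\in s_1^*\}$. Gleason map: for each $s^*\in\mathcal S^*$, $\bigcap_{B\in s^*}\mathrm{clos}(\widehat B)\subseteq\widehat{\mathcal S}$ has exactly one element, denoted $p_{\mathcal C}(s^* )$; $p_{\mathcal C}:\mathcal S^*\to\widehat{\mathcal S}$ is a continuous surjection. Integration spaces: an integration space is a triple $(\mathcal S,\mathcal G,\mathbb I)$ where $\mathcal S$ is locally compact Hausdorff, $\mathcal G$ is a linear subspace of $\mathcal C(\mathcal S,\mathbb R)$, and $\mathbb I:\mathcal G\to\mathbb R$ is a nondecreasing bounded linear functional of norm $1$. A morphism from $(\mathcal S_1,\mathcal G_1,\mathbb I_1)$ to $(\mathcal S_2,\mathcal G_2,\mathbb I_2)$ is a continuous $\phi:\mathcal S_1\to\mathcal S_2$ such that $g\circ\phi\in\mathcal G_1$ and $\mathbb I_1[g\circ\phi]=\mathbb I_2[g]$ for all $g\in\mathcal G_2$. $\mathbf{CmpInt}$ is the category of integration spaces with $\mathcal S$ compact. The functor $\Upsilon$: $\Upsilon(\mathcal S,\mathfrak B,\mu):=(\mathcal S,\mathcal G_{\mathfrak B}(\mathcal S),\fint_{\mathcal S}\,\cdot\,d\mu)$ and $\Upsilon(\phi):=\phi$. Here $\mathcal G_{\mathfrak B}(\mathcal S)$ is the closed linear span, in the bounded continuous real functions with uniform norm, of those bounded continuous $f$ with $\mathrm{int}(f^{-1}(-\infty,r])\in\mathfrak B$ and $\mathrm{int}(f^{-1}[r,\infty))\in\mathfrak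 B$ for all $r\in\mathbb R$. The integral is defined as follows: $f:\mathcal S\to\mathbb R$ is $\mathfrak B$-simple if it is constant, with value $r_n$, on each cell $P_n$ of some finite family $\{P_1,\dots,P_N\}$ of disjoint elements of $\mathfrak B$ with join $\mathcal S$; for bounded such $f$, $\fint_{\mathcal S}f\,d\mu:=\sum_n r_n\mu[P_n]$; and for $g\in\mathcal G_{\mathfrak B}(\mathcal S)$, $\fint_{\mathcal S}g\,d\mu$ is the supremum of $\fint_{\mathcal S}f\,d\mu$ over bounded $\mathfrak B$-simple $f\le g$. The functor $\Xi$: for a compact Hausdorff space $\mathcal S$ with Borel probability measure $\mu$, $\Xi(\mathcal S,\mu):=(\mathcal S,\mathcal C(\mathcal S,\mathbb R),g\mapsto\int_{\mathcal S}g\,d\mu)$, and $\Xi(\phi):=\phi$ for continuous measure-preserving $\phi$. *)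

theory Defs
  imports "HOL-Analysis.Analysis" "HOL-Probability.Probability"
begin

section \<open>Regular open sets, Boolean subalgebras and contents\<close>

definition regular_open_in :: "'a topology \<Rightarrow> 'a set \<Rightarrow> bool" where
  "regular_open_in X R \<longleftrightarrow> openin X R \<and> R = X interior_of (X closure_of R)"

definition regular_join :: "'a topology \<Rightarrow> 'a set \<Rightarrow> 'a set \<Rightarrow> 'a set" where
  "regular_join X Q R = X interior_of (X closure_of (Q \<union> R))"

text \<open>The join \<open>B\<^sub>1 \<or> \<dots> \<or> B\<^sub>N\<close> of a finite family, as a supremum in the algebra of regular open sets.\<close>

definition regular_Join :: "'a topology \<Rightarrow> nat \<Rightarrow> (nat \<Rightarrow> 'a set) \<Rightarrow> 'a set" where
  "regular_Join X N B = X interior_of (X closure_of (\<Union>n<N. B n))"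

definition regular_neg :: "'a topology \<Rightarrow> 'a set \<Rightarrow> 'a set" where
  "regular_neg X R = X interior_of (topspace X - R)"

text \<open>The unit \<open>topspace X\<close> is required explicitly: the closure conditions alone would admit
  the empty collection.\<close>

definition boolean_subalgebra :: "'a topology \<Rightarrow> 'a set set \<Rightarrow> bool" where
  "boolean_subalgebra X \<BB> \<longleftrightarrow>
     \<BB> \<subseteq> Collect (regular_open_in X) \<and> topspace X \<in> \<BB> \<and>
     (\<forall>Q\<in>\<BB>. \<forall>R\<in>\<BB>. Q \<inter> R \<in> \<BB> \<and> regular_join X Q R \<in> \<BB>) \<and>
     (\<forall>R\<in>\<BB>. regular_neg X R \<in> \<BB>)"

definition content_on :: "'a topology \<Rightarrow> 'a set set \<Rightarrow> ('a set \<Rightarrow> real) \<Rightarrow> bool" where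
  "content_on X \<BB> \<mu> \<longleftrightarrow>
     (\<forall>B\<in>\<BB>. 0 \<le> \<mu> B) \<and>
     (\<forall>N B. (\<forall>n<N. B n \<in> \<BB>) \<and> disjoint_family_on B {..<N} \<longrightarrow>
        \<mu> (regular_Join X N B) = (\<Sum>n<N. \<mu> (B n)))"

section \<open>Stone-Cech compactification\<close>

text \<open>Realised as the closure of the image of the evaluation map in the cube
  \<open>[0,1]\<^bsup>C(X,[0,1])\<^esup>\<close>. Elements of \<open>C(X,[0,1])\<close> are taken extensional, so that each function on
  \<open>topspace X\<close> contributes one coordinate.\<close>

definition unit_functions :: "'a topology \<Rightarrow> ('a \<Rightarrow> real) set" where
  "unit_functions X =
     {f \<in> extensional (topspace X). continuous_map X (top_of_set {0..1}) f}"

definition unit_cube :: "'a topology \<Rightarrow> (('a \<Rightarrow> real) \<Rightarrow> real) topology" where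
  "unit_cube X = product_topology (\<lambda>_. top_of_set {0..1}) (unit_functions X)"

definition sc_embed :: "'a topology \<Rightarrow> 'a \<Rightarrow> (('a \<Rightarrow> real) \<Rightarrow> real)" where
  "sc_embed X x = (\<lambda>f\<in>unit_functions X. f x)"

definition stone_cech :: "'a topology \<Rightarrow> (('a \<Rightarrow> real) \<Rightarrow> real) topology" where
  "stone_cech X =
     subtopology (unit_cube X) (unit_cube X closure_of (sc_embed X ` topspace X))"

text \<open>The space \<open>X\<close> is identified with its image under \<open>sc_embed X\<close>, so for \<open>Q \<subseteq> \<beta>X\<close> the
  intersection \<open>Q \<inter> X\<close> is \<open>sc_trace X Q\<close>.\<close>

definition sc_trace :: "'a topology \<Rightarrow> (('a \<Rightarrow> real) \<Rightarrow> real) set \<Rightarrow> 'a set" where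
  "sc_trace X Q = {x \<in> topspace X. sc_embed X x \<in> Q}"

definition sc_hat :: "'a topology \<Rightarrow> 'a set \<Rightarrow> (('a \<Rightarrow> real) \<Rightarrow> real) set" where
  "sc_hat X R = (THE Q. regular_open_in (stone_cech X) Q \<and> sc_trace X Q = R)"

text \<open>Maps out of \<open>\<beta>X\<close> are taken extensional, to make the continuous extension unique as a HOL
  function.\<close>

definition sc_extend ::
  "'a topology \<Rightarrow> 'b topology \<Rightarrow> ('a \<Rightarrow> 'b) \<Rightarrow> (('a \<Rightarrow> real) \<Rightarrow> real) \<Rightarrow> (('b \<Rightarrow> real) \<Rightarrow> real)" where
  "sc_extend X Y \<phi> =
     (THE \<psi>. \<psi> \<in> extensional (topspace (stone_cech X)) \<and>
        continuous_map (stone_cech X) (stone_cech Y) \<psi> \<and>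
        (\<forall>x\<in>topspace X. \<psi> (sc_embed X x) = sc_embed Y (\<phi> x)))"

definition generative :: "'a topology \<Rightarrow> 'a set set \<Rightarrow> bool" where
  "generative X \<BB> \<longleftrightarrow>
     openin (stone_cech X) = arbitrary union_of (\<lambda>U. U \<in> sc_hat X ` \<BB>)"

section \<open>Content spaces\<close>

record 'a content_triple =
  cont_top :: "'a topology"
  cont_alg :: "'a set set"
  cont_msr :: "'a set \<Rightarrow> real"

definition content_space :: "'a content_triple \<Rightarrow> bool" where
  "content_space C \<longleftrightarrow>
     locally_compact_space (cont_top C) \<and> Hausdorff_space (cont_top C) \<and>
     boolean_subalgebra (cont_top C) (cont_alg C) \<and>
     generative (cont_top C) (cont_alg C) \<and>
     content_on (cont_top C) (cont_alg C) (cont_msr C) \<and>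
     cont_msr C (topspace (cont_top C)) = 1"

definition inverse_image :: "'a topology \<Rightarrow> ('a \<Rightarrow> 'b) \<Rightarrow> 'b set \<Rightarrow> 'a set" where
  "inverse_image X \<phi> B = {x \<in> topspace X. \<phi> x \<in> B}"

definition boolean_hom ::
  "'b topology \<Rightarrow> 'b set set \<Rightarrow> 'a topology \<Rightarrow> 'a set set \<Rightarrow> ('b set \<Rightarrow> 'a set) \<Rightarrow> bool" where
  "boolean_hom Y \<AA> X \<BB> h \<longleftrightarrow>
     (\<forall>Q\<in>\<AA>. h Q \<in> \<BB>) \<and>
     (\<forall>Q\<in>\<AA>. \<forall>R\<in>\<AA>. h (Q \<inter> R) = h Q \<inter> h R \<and>
        h (regular_join Y Q R) = regular_join X (h Q) (h R)) \<and>
     (\<forall>Q\<in>\<AA>. h (regular_neg Y Q) = regular_neg X (h Q))"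

definition content_morphism ::
  "'a content_triple \<Rightarrow> 'b content_triple \<Rightarrow> ('a \<Rightarrow> 'b) \<Rightarrow> bool" where
  "content_morphism C1 C2 \<phi> \<longleftrightarrow>
     content_space C1 \<and> content_space C2 \<and>
     continuous_map (cont_top C1) (cont_top C2) \<phi> \<and>
     boolean_hom (cont_top C2) (cont_alg C2) (cont_top C1) (cont_alg C1)
       (inverse_image (cont_top C1) \<phi>) \<and>
     (\<forall>B\<in>cont_alg C2. cont_msr C1 (inverse_image (cont_top C1) \<phi> B) = cont_msr C2 B)"

subsection \<open>The functor \<open>\<beta>\<close>\<close>

text \<open>Every \<open>Q\<close> in the extended algebra is the hat of its own trace, so the extended content is
  evaluated on the trace.\<close>

definition beta_obj :: "'a content_triple \<Rightarrow> (('a \<Rightarrow> real) \<Rightarrow> real) content_triple" where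
  "beta_obj C =
     \<lparr>cont_top = stone_cech (cont_top C),
      cont_alg = sc_hat (cont_top C) ` cont_alg C,
      cont_msr = (\<lambda>Q. cont_msr C (sc_trace (cont_top C) Q))\<rparr>"

definition beta_arr ::
  "'a content_triple \<Rightarrow> 'b content_triple \<Rightarrow> ('a \<Rightarrow> 'b) \<Rightarrow>
     (('a \<Rightarrow> real) \<Rightarrow> real) \<Rightarrow> (('b \<Rightarrow> real) \<Rightarrow> real)" where
  "beta_arr C1 C2 \<phi> = sc_extend (cont_top C1) (cont_top C2) \<phi>"

subsection \<open>The functor \<open>\<sigma>\<close>\<close>

definition ultrafilter_of :: "'a topology \<Rightarrow> 'a set set \<Rightarrow> 'a set set \<Rightarrow> bool" where
  "ultrafilter_of X \<BB> s \<longleftrightarrow>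
     s \<subseteq> \<BB> \<and> topspace X \<in> s \<and> {} \<notin> s \<and>
     (\<forall>Q\<in>s. \<forall>R\<in>s. Q \<inter> R \<in> s) \<and>
     (\<forall>Q\<in>s. \<forall>R\<in>\<BB>. Q \<subseteq> R \<longrightarrow> R \<in> s) \<and>
     (\<forall>R\<in>\<BB>. R \<in> s \<or> regular_neg X R \<in> s)"

definition stone_clopen :: "'a topology \<Rightarrow> 'a set set \<Rightarrow> 'a set \<Rightarrow> 'a set set set" where
  "stone_clopen X \<BB> B = {s. ultrafilter_of X \<BB> s \<and> B \<in> s}"

definition stone_space :: "'a topology \<Rightarrow> 'a set set \<Rightarrow> 'a set set topology" where
  "stone_space X \<BB> = topology_generated_by (stone_clopen X \<BB> ` \<BB>)"

definition normal_borel_prob :: "'a topology \<Rightarrow> 'a measure \<Rightarrow> bool" where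
  "normal_borel_prob T M \<longleftrightarrow>
     sets M = sigma_sets (topspace T) {U. openin T U} \<and> prob_space M \<and>
     (\<forall>E\<in>sets M.
        emeasure M E = (SUP K\<in>{K. closedin T K \<and> K \<subseteq> E}. emeasure M K) \<and>
        emeasure M E = (INF U\<in>{U. openin T U \<and> E \<subseteq> U}. emeasure M U))"

definition stone_measure :: "'a content_triple \<Rightarrow> 'a set set measure" where
  "stone_measure C =
     (THE M. normal_borel_prob (stone_space (cont_top C) (cont_alg C)) M \<and>
        (\<forall>B\<in>cont_alg C.
           measure M (stone_clopen (cont_top C) (cont_alg C) B) = cont_msr C B))"

definition sigma_obj :: "'a content_triple \<Rightarrow> 'a set set topology \<times> 'a set set measure" where
  "sigma_obj C = (stone_space (cont_top C) (cont_alg C), stone_measure C)"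

definition sigma_arr ::
  "'a content_triple \<Rightarrow> 'b content_triple \<Rightarrow> ('a \<Rightarrow> 'b) \<Rightarrow> 'a set set \<Rightarrow> 'b set set" where
  "sigma_arr C1 C2 \<phi> s = {B \<in> cont_alg C2. inverse_image (cont_top C1) \<phi> B \<in> s}"

subsection \<open>The Gleason map\<close>

definition gleason :: "'a content_triple \<Rightarrow> 'a set set \<Rightarrow> (('a \<Rightarrow> real) \<Rightarrow> real)" where
  "gleason C s =
     the_elem (\<Inter>B\<in>s. stone_cech (cont_top C) closure_of (sc_hat (cont_top C) B))"

section \<open>Integration spaces\<close>

record 'a integration_triple =
  itg_top :: "'a topology"
  itg_fns :: "('a \<Rightarrow> real) set"
  itg_fun :: "('a \<Rightarrow> real) \<Rightarrow> real"

text \<open>A real function on \<open>topspace X\<close> is represented by all HOL functions that agree with it on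
  \<open>topspace X\<close>; hence a space of functions is required to be closed under changing values off
  \<open>topspace X\<close> (monotonicity makes the functional independent of these values).
  The last two conditions say that the operator norm for the uniform norm is finite and
  equal to \<open>1\<close>.\<close>

definition integration_space :: "'a integration_triple \<Rightarrow> bool" where
  "integration_space I \<longleftrightarrow>
     (let X = itg_top I; G = itg_fns I; J = itg_fun I;
          V = {\<bar>J g\<bar> | g. g \<in> G \<and> (\<forall>x\<in>topspace X. \<bar>g x\<bar> \<le> 1)} in
        locally_compact_space X \<and> Hausdorff_space X \<and>
        (\<forall>g\<in>G. continuous_map X euclideanreal g) \<and>
        (\<forall>g\<in>G. \<forall>h. (\<forall>x\<in>topspace X. h x = g x) \<longrightarrow> h \<in> G) \<and>
        (\<lambda>x. 0) \<in> G \<and>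
        (\<forall>f\<in>G. \<forall>g\<in>G. (\<lambda>x. f x + g x) \<in> G \<and> J (\<lambda>x. f x + g x) = J f + J g) \<and>
        (\<forall>c. \<forall>g\<in>G. (\<lambda>x. c * g x) \<in> G \<and> J (\<lambda>x. c * g x) = c * J g) \<and>
        (\<forall>f\<in>G. \<forall>g\<in>G. (\<forall>x\<in>topspace X. f x \<le> g x) \<longrightarrow> J f \<le> J g) \<and>
        bdd_above V \<and> Sup V = 1)"

definition integration_morphism ::
  "'a integration_triple \<Rightarrow> 'b integration_triple \<Rightarrow> ('a \<Rightarrow> 'b) \<Rightarrow> bool" where
  "integration_morphism I1 I2 \<phi> \<longleftrightarrow>
     integration_space I1 \<and> integration_space I2 \<and>
     continuous_map (itg_top I1) (itg_top I2) \<phi> \<and>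
     (\<forall>g\<in>itg_fns I2. g \<circ> \<phi> \<in> itg_fns I1 \<and> itg_fun I1 (g \<circ> \<phi>) = itg_fun I2 g)"

definition CmpInt_morphism ::
  "'a integration_triple \<Rightarrow> 'b integration_triple \<Rightarrow> ('a \<Rightarrow> 'b) \<Rightarrow> bool" where
  "CmpInt_morphism I1 I2 \<phi> \<longleftrightarrow>
     compact_space (itg_top I1) \<and> compact_space (itg_top I2) \<and> integration_morphism I1 I2 \<phi>"

subsection \<open>The functor \<open>\<Upsilon>\<close>\<close>

definition comeasurable :: "'a topology \<Rightarrow> 'a set set \<Rightarrow> ('a \<Rightarrow> real) \<Rightarrow> bool" where
  "comeasurable X \<BB> f \<longleftrightarrow>
     continuous_map X euclideanreal f \<and> bounded (f ` topspace X) \<and>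
     (\<forall>r. X interior_of {x \<in> topspace X. f x \<le> r} \<in> \<BB> \<and>
          X interior_of {x \<in> topspace X. r \<le> f x} \<in> \<BB>)"

definition comeasurable_span :: "'a topology \<Rightarrow> 'a set set \<Rightarrow> ('a \<Rightarrow> real) set" where
  "comeasurable_span X \<BB> =
     {\<lambda>x. \<Sum>i<n. c i * f i x | (n::nat) c f. \<forall>i<n. comeasurable X \<BB> (f i)}"

definition comeasurable_closed_span :: "'a topology \<Rightarrow> 'a set set \<Rightarrow> ('a \<Rightarrow> real) set" where
  "comeasurable_closed_span X \<BB> =
     {g. continuous_map X euclideanreal g \<and> bounded (g ` topspace X) \<and>
         (\<forall>\<epsilon>>0. \<exists>h\<in>comeasurable_span X \<BB>. \<forall>x\<in>topspace X. \<bar>g x - h x\<bar> \<le> \<epsilon>)}"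

text \<open>\<open>f\<close> is constant with value \<open>r n\<close> on the cell \<open>P n\<close>; off the cells its values are
  unconstrained.\<close>

definition simple_rep ::
  "'a topology \<Rightarrow> 'a set set \<Rightarrow> ('a \<Rightarrow> real) \<Rightarrow> nat \<Rightarrow> (nat \<Rightarrow> 'a set) \<Rightarrow> (nat \<Rightarrow> real) \<Rightarrow> bool" where
  "simple_rep X \<BB> f N P r \<longleftrightarrow>
     (\<forall>n<N. P n \<in> \<BB>) \<and> disjoint_family_on P {..<N} \<and> regular_Join X N P = topspace X \<and>
     (\<forall>n<N. \<forall>x\<in>P n. f x = r n)"

definition bounded_simple :: "'a topology \<Rightarrow> 'a set set \<Rightarrow> ('a \<Rightarrow> real) \<Rightarrow> bool" where
  "bounded_simple X \<BB> f \<longleftrightarrow> bounded (f ` topspace X) \<and> (\<exists>N P r. simple_rep X \<BB> f N P r)"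

definition simple_content_integral ::
  "'a topology \<Rightarrow> 'a set set \<Rightarrow> ('a set \<Rightarrow> real) \<Rightarrow> ('a \<Rightarrow> real) \<Rightarrow> real" where
  "simple_content_integral X \<BB> \<mu> f =
     (THE v. \<exists>N P r. simple_rep X \<BB> f N P r \<and> v = (\<Sum>n<N. r n * \<mu> (P n)))"

definition content_integral ::
  "'a topology \<Rightarrow> 'a set set \<Rightarrow> ('a set \<Rightarrow> real) \<Rightarrow> ('a \<Rightarrow> real) \<Rightarrow> real" where
  "content_integral X \<BB> \<mu> g =
     Sup {simple_content_integral X \<BB> \<mu> f | f.
            bounded_simple X \<BB> f \<and> (\<forall>x\<in>topspace X. f x \<le> g x)}"

text \<open>On arrows, \<open>\<Upsilon>\<close> and \<open>\<Xi>\<close> leave the underlying map unchanged.\<close>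

definition Upsilon_obj :: "'a content_triple \<Rightarrow> 'a integration_triple" where
  "Upsilon_obj C =
     \<lparr>itg_top = cont_top C,
      itg_fns = comeasurable_closed_span (cont_top C) (cont_alg C),
      itg_fun = content_integral (cont_top C) (cont_alg C) (cont_msr C)\<rparr>"

subsection \<open>The functor \<open>\<Xi>\<close>\<close>

definition Xi_obj :: "'a topology \<times> 'a measure \<Rightarrow> 'a integration_triple" where
  "Xi_obj = (\<lambda>(X, M).
     \<lparr>itg_top = X,
      itg_fns = {g. continuous_map X euclideanreal g},
      itg_fun = (\<lambda>g. integral\<^sup>L M g)\<rparr>)"

end

theory Submission
  imports Defs
begin

text \<open>
  Identify the algebra \<open>\<BB>\<close> with its clopen copy on the Stone space \<open>S\<close>. A \<open>\<BB>\<close>-simple function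
  with cells \<open>P\<^sub>n\<close> and values \<open>r\<^sub>n\<close> on \<open>\<beta>X\<close> turns into the step function on \<open>S\<close> with value \<open>r\<^sub>n\<close> on
  \<open>P\<^sub>n\<^sup>*\<close>, whose integral is \<open>\<Sum> r\<^sub>n \<mu>[P\<^sub>n]\<close>. Since the Gleason map \<open>p\<close> sends \<open>P\<^sub>n\<^sup>*\<close> into the closure of
  \<open>P\<^sub>n\<close>, lying below \<open>g\<close> on \<open>\<beta>X\<close> forces lying below \<open>g \<circ> p\<close> on \<open>S\<close>. Conversely the hats of \<open>\<BB>\<close> are
  a base of a compact space, so \<open>\<beta>X\<close> has finite partitions in the algebra on whose cells \<open>g\<close> oscillates
  by at most \<open>\<epsilon>\<close>. Hence the content integral of \<open>g\<close> is \<open>\<integral> g \<circ> p d\<mu>\<^sup>*\<close> for every continuous \<open>g\<close> on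
  \<open>\<beta>X\<close>, not just for those in the closed span of the comeasurable functions. Naturality holds
  because \<open>p(s)\<close> is the only point in the closures of all hats of members of \<open>s\<close>, and continuous
  maps respect closures.
\<close>

section \<open>Regular open sets\<close>

lemma regular_open_in_Int:
  assumes "regular_open_in X A" "regular_open_in X B"
  shows "regular_open_in X (A \<inter> B)"
proof -
  have o: "openin X (A \<inter> B)" using assms by (auto simp: regular_open_in_def)
  have "X interior_of (X closure_of (A \<inter> B)) \<subseteq> X interior_of (X closure_of A) \<inter> X interior_of (X closure_of B)"
    by (simp add: closure_of_mono interior_of_mono)
  then have "X interior_of (X closure_of (A \<inter> B)) \<subseteq> A \<inter> B"
    using assms by (auto simp: regular_open_in_def)
  moreover have "A \<inter> B \<subseteq> X interior_of (X closure_of (A \<inter> B))"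
    using o by (simp add: closure_of_subset interior_of_maximal openin_subset)
  ultimately show ?thesis using o by (auto simp: regular_open_in_def)
qed

text \<open>Closedness keeps the closure of the interior inside \<open>K\<close>, so a second
  interior adds nothing. Regular complements and hats are both obtained as interiors of closed
  sets.\<close>

lemma interior_of_closedin_regular:
  assumes "closedin X K"
  shows "regular_open_in X (X interior_of K)"
proof -
  have "X closure_of (X interior_of K) \<subseteq> K"
    using assms by (simp add: closure_of_minimal interior_of_subset)
  then have "X interior_of (X closure_of (X interior_of K)) \<subseteq> X interior_of K"
    by (rule interior_of_mono)
  moreover have "X interior_of K \<subseteq> X interior_of (X closure_of (X interior_of K))"
    by (simp add: closure_of_subset interior_of_maximal openin_subset)
  ultimately show ?thesis by (simp add: regular_open_in_def subset_antisym)
qed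

lemma regular_open_in_neg: "openin X R \<Longrightarrow> regular_open_in X (regular_neg X R)"
  unfolding regular_neg_def by (rule interior_of_closedin_regular) auto

lemma openin_regular_neg [simp]: "openin X (regular_neg X R)"
  by (simp add: regular_neg_def)

lemma regular_neg_disjoint: "R \<inter> regular_neg X R = {}"
  using interior_of_subset[of X "topspace X - R"] by (auto simp: regular_neg_def)

lemma subset_regular_neg: "openin X U \<Longrightarrow> U \<inter> R = {} \<Longrightarrow> U \<subseteq> regular_neg X R"
  unfolding regular_neg_def by (rule interior_of_maximal) (use openin_subset in fastforce)+

text \<open>An open set missing the complement of \<open>B\<close> lies in the closure of
  \<open>B\<close>, hence in the interior of that closure, which is \<open>B\<close> by
  regularity.\<close>

lemma subset_if_disjoint_regular_neg:
  assumes "openin X A" "regular_open_in X B" "A \<inter> regular_neg X B = {}"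
  shows "A \<subseteq> B"
proof -
  have "A \<inter> (topspace X - X closure_of B) = {}"
    using assms by (simp add: regular_neg_def interior_of_complement)
  then have "A \<subseteq> X closure_of B" using openin_subset[OF assms(1)] by blast
  then have "A \<subseteq> X interior_of (X closure_of B)" using assms(1) by (rule interior_of_maximal)
  then show ?thesis using assms(2) by (simp add: regular_open_in_def)
qed

text \<open>De Morgan's law: joins on the Stone space can be handled through meets and
  complements.\<close>

lemma regular_join_eq_neg:
  "regular_join X A B = regular_neg X (regular_neg X A \<inter> regular_neg X B)"
proof -
  have "topspace X - regular_neg X A \<inter> regular_neg X B = X closure_of (A \<union> B)"
    using closure_of_subset_topspace[of X]
    by (auto simp: regular_neg_def interior_of_complement)
  then show ?thesis unfolding regular_neg_def[of X "_ \<inter> _"] by (simp add: regular_join_def)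
qed

section \<open>The Stone-Cech compactification\<close>

lemma compact_space_unit_cube: "compact_space (unit_cube X)"
  unfolding unit_cube_def
  by (simp add: compact_space_product_topology compact_space_subtopology)

lemma Hausdorff_space_unit_cube: "Hausdorff_space (unit_cube X)"
  unfolding unit_cube_def
  by (simp add: Hausdorff_space_product_topology Hausdorff_space_subtopology)

lemma compact_space_stone_cech: "compact_space (stone_cech X)"
  unfolding stone_cech_def
  by (simp add: closedin_compact_space compact_space_subtopology compact_space_unit_cube)

lemma Hausdorff_space_stone_cech: "Hausdorff_space (stone_cech X)"
  unfolding stone_cech_def by (simp add: Hausdorff_space_subtopology Hausdorff_space_unit_cube)

lemma topspace_stone_cech:
  "topspace (stone_cech X) = unit_cube X closure_of (sc_embed X ` topspace X)"
  by (simp add: stone_cech_def closure_of_subset_topspace Int_absorb1)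

lemma continuous_map_sc_embed_cube: "continuous_map X (unit_cube X) (sc_embed X)"
  unfolding unit_cube_def continuous_map_componentwise
  by (auto simp: sc_embed_def unit_functions_def)

lemma sc_embed_image_subset: "sc_embed X ` topspace X \<subseteq> topspace (stone_cech X)"
  unfolding topspace_stone_cech
  by (simp add: closure_of_subset continuous_map_image_subset_topspace continuous_map_sc_embed_cube)

lemma continuous_map_sc_embed: "continuous_map X (stone_cech X) (sc_embed X)"
  using continuous_map_sc_embed_cube[of X] sc_embed_image_subset[of X]
  unfolding topspace_stone_cech
  by (simp add: stone_cech_def continuous_map_in_subtopology image_subset_iff_funcset)

lemma stone_cech_dense: "stone_cech X closure_of (sc_embed X ` topspace X) = topspace (stone_cech X)"
  using sc_embed_image_subset[of X] unfolding topspace_stone_cech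
  by (simp add: stone_cech_def closure_of_subtopology Int_absorb1)

lemma continuous_map_stone_cech_projection:
  "f \<in> unit_functions X \<Longrightarrow> continuous_map (stone_cech X) (top_of_set {0..1}) (\<lambda>z. z f)"
  unfolding stone_cech_def unit_cube_def
  by (intro continuous_map_from_subtopology continuous_map_product_projection)

section \<open>Traces of open sets of the compactification on the original space\<close>

lemma sc_trace_Int: "sc_trace X (P \<inter> Q) = sc_trace X P \<inter> sc_trace X Q"
  by (auto simp: sc_trace_def)

lemma openin_sc_trace: "openin (stone_cech X) U \<Longrightarrow> openin X (sc_trace X U)"
  unfolding sc_trace_def by (rule openin_continuous_map_preimage[OF continuous_map_sc_embed])

text \<open>A nonempty open set meets the dense image of \<open>X\<close>. Disjointness of open sets
  can thus be tested on their traces.\<close>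

lemma sc_trace_eq_empty_iff:
  "openin (stone_cech X) U \<Longrightarrow> sc_trace X U = {} \<longleftrightarrow> U = {}"
proof
  assume U: "openin (stone_cech X) U" and "sc_trace X U = {}"
  then have "U \<inter> sc_embed X ` topspace X = {}" by (auto simp: sc_trace_def)
  then have "U \<inter> topspace (stone_cech X) = {}"
    using openin_Int_closure_of_eq_empty[OF U] stone_cech_dense by metis
  then show "U = {}" using openin_subset[OF U] by blast
qed (simp add: sc_trace_def)

text \<open>An open set and its intersection with a dense set have the same closure.\<close>

lemma closure_of_sc_trace:
  assumes "openin (stone_cech X) U"
  shows "stone_cech X closure_of (sc_embed X ` sc_trace X U) = stone_cech X closure_of U"
proof -
  have "sc_embed X ` sc_trace X U = U \<inter> sc_embed X ` topspace X" by (auto simp: sc_trace_def)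
  then show ?thesis
    using closure_of_openin_Int_superset[of "stone_cech X" U "sc_embed X ` topspace X"]
      assms openin_subset[OF assms] by (simp add: stone_cech_dense)
qed

text \<open>The topology of \<open>X\<close> is induced by \<open>sc_embed\<close>. Complete
  regularity gives, for each point of \<open>R\<close>, a coordinate that is 0 there and 1 off
  \<open>R\<close>; the open half-space where this coordinate is below 1 has its trace inside
  \<open>R\<close>.\<close>

lemma sc_trace_surj:
  assumes X: "completely_regular_space X" and R: "openin X R"
  obtains U where "openin (stone_cech X) U" "sc_trace X U = R"
proof
  let ?\<U> = "{V. openin (stone_cech X) V \<and> sc_trace X V \<subseteq> R}"
  show "openin (stone_cech X) (\<Union>?\<U>)" by auto
  have "x \<in> sc_trace X (\<Union>?\<U>)" if x: "x \<in> R" for x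
  proof -
    have xX: "x \<in> topspace X" using R openin_subset x by blast
    have "closedin X (topspace X - R) \<and> x \<in> topspace X - (topspace X - R)" using R x xX by blast
    then obtain f :: "'a \<Rightarrow> real" where f: "continuous_map X (top_of_set {0..1}) f" "f x = 0"
        "f ` (topspace X - R) \<subseteq> {1}"
      using X unfolding completely_regular_space_def by metis
    \<comment> \<open>Coordinates of the cube are indexed by extensional functions, hence the
      restriction.\<close>
    define g where "g = restrict f (topspace X)"
    have "continuous_map X (top_of_set {0..1}) g"
      by (rule continuous_map_eq[OF f(1)]) (simp add: g_def)
    then have g: "g \<in> unit_functions X"
      by (simp add: unit_functions_def g_def)
    define V where "V = {z \<in> topspace (stone_cech X). z g \<in> {..<1}}"
    have "continuous_map (stone_cech X) euclideanreal (\<lambda>z. z g)"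
      using continuous_map_stone_cech_projection[OF g] by (simp add: continuous_map_in_subtopology)
    then have "openin (stone_cech X) V"
      unfolding V_def by (rule openin_continuous_map_preimage) simp
    moreover have "sc_trace X V \<subseteq> R"
      using f(3) g by (fastforce simp: sc_trace_def V_def sc_embed_def g_def)
    moreover have "x \<in> sc_trace X V"
      using xX f(2) g sc_embed_image_subset[of X] by (auto simp: sc_trace_def V_def sc_embed_def g_def)
    ultimately show ?thesis by (auto simp: sc_trace_def)
  qed
  then show "sc_trace X (\<Union>?\<U>) = R" by (auto simp: sc_trace_def)
qed

section \<open>Extension of regular open sets\<close>

lemma regular_open_in_stone_cech_eq:
  assumes "regular_open_in (stone_cech X) Q"
  shows "Q = stone_cech X interior_of (stone_cech X closure_of (sc_embed X ` sc_trace X Q))"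
  using assms by (simp add: regular_open_in_def closure_of_sc_trace)

text \<open>Existence of the hat. The trace contains \<open>R\<close> because \<open>R\<close>
  extends to an open set; conversely it is an open set inside the closure of \<open>R\<close>, hence
  inside the interior of that closure, which is \<open>R\<close>.\<close>

lemma sc_trace_interior_of_closure_of:
  assumes X: "completely_regular_space X" and R: "regular_open_in X R"
  shows "sc_trace X (stone_cech X interior_of (stone_cech X closure_of (sc_embed X ` R))) = R"
proof -
  obtain U where U: "openin (stone_cech X) U" "sc_trace X U = R"
    using sc_trace_surj[OF X] R unfolding regular_open_in_def by blast
  let ?Q = "stone_cech X interior_of (stone_cech X closure_of (sc_embed X ` R))"
  have eq: "stone_cech X closure_of (sc_embed X ` R) = stone_cech X closure_of U"
    using closure_of_sc_trace[OF U(1)] U(2) by simp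
  have "U \<subseteq> ?Q"
    unfolding eq using U(1) by (simp add: closure_of_subset interior_of_maximal openin_subset)
  then have "R \<subseteq> sc_trace X ?Q" using U(2) by (auto simp: sc_trace_def)
  moreover have "sc_trace X ?Q \<subseteq> X closure_of R"
  proof
    fix x assume x: "x \<in> sc_trace X ?Q"
    then have xX: "x \<in> topspace X" and xc: "sc_embed X x \<in> stone_cech X closure_of U"
      using interior_of_subset[of "stone_cech X" "stone_cech X closure_of U"] by (auto simp: sc_trace_def eq)
    show "x \<in> X closure_of R"
      unfolding in_closure_of
    proof (intro conjI allI impI xX)
      fix W assume "x \<in> W \<and> openin X W"
      \<comment> \<open>The neighbourhood \<open>W\<close> is extended to the compactification,
        where it must meet \<open>U\<close>; density brings a common point back to
        \<open>X\<close>.\<close>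
      moreover then obtain V where V: "openin (stone_cech X) V" "sc_trace X V = W"
        using sc_trace_surj[OF X] by blast
      ultimately have "sc_embed X x \<in> V" by (auto simp: sc_trace_def)
      then have "V \<inter> U \<noteq> {}" using xc V(1) by (auto simp: in_closure_of)
      then have "sc_trace X (V \<inter> U) \<noteq> {}" using sc_trace_eq_empty_iff U V by blast
      then show "\<exists>y. y \<in> R \<and> y \<in> W" using U V by (auto simp: sc_trace_Int)
    qed
  qed
  then have "sc_trace X ?Q \<subseteq> X interior_of (X closure_of R)"
    by (simp add: interior_of_maximal openin_sc_trace)
  ultimately show ?thesis using R by (simp add: regular_open_in_def subset_antisym)
qed

text \<open>By density a regular open set has the same closure as its embedded trace and is the
  interior of that closure, so the trace determines it and the definite description is
  justified.\<close>

lemma sc_hat_eq: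
  assumes X: "completely_regular_space X" and R: "regular_open_in X R"
  shows "sc_hat X R = stone_cech X interior_of (stone_cech X closure_of (sc_embed X ` R))"
  unfolding sc_hat_def
proof (rule the_equality)
  show "regular_open_in (stone_cech X) (stone_cech X interior_of (stone_cech X closure_of (sc_embed X ` R))) \<and>
     sc_trace X (stone_cech X interior_of (stone_cech X closure_of (sc_embed X ` R))) = R"
    using sc_trace_interior_of_closure_of[OF assms] by (simp add: interior_of_closedin_regular)
next
  fix Q assume "regular_open_in (stone_cech X) Q \<and> sc_trace X Q = R"
  then show "Q = stone_cech X interior_of (stone_cech X closure_of (sc_embed X ` R))"
    using regular_open_in_stone_cech_eq by metis
qed

lemma regular_open_in_sc_hat:
  "completely_regular_space X \<Longrightarrow> regular_open_in X R \<Longrightarrow> regular_open_in (stone_cech X) (sc_hat X R)"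
  by (simp add: sc_hat_eq interior_of_closedin_regular)

lemma sc_trace_sc_hat:
  "completely_regular_space X \<Longrightarrow> regular_open_in X R \<Longrightarrow> sc_trace X (sc_hat X R) = R"
  by (simp add: sc_hat_eq sc_trace_interior_of_closure_of)

text \<open>The tool for computing hats: a regular open set is recognised as a hat by its trace
  alone.\<close>

lemma sc_hat_sc_trace:
  assumes "completely_regular_space X" "regular_open_in (stone_cech X) Q" "regular_open_in X (sc_trace X Q)"
  shows "sc_hat X (sc_trace X Q) = Q"
  using assms sc_hat_eq regular_open_in_stone_cech_eq by metis

lemma sc_hat_Int:
  assumes X: "completely_regular_space X" and A: "regular_open_in X A" and B: "regular_open_in X B"
  shows "sc_hat X (A \<inter> B) = sc_hat X A \<inter> sc_hat X B"
  using sc_hat_sc_trace[OF X, of "sc_hat X A \<inter> sc_hat X B"]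
  by (simp add: sc_trace_Int sc_trace_sc_hat X A B regular_open_in_Int regular_open_in_sc_hat)

text \<open>Both inclusions use that the complement is the largest open set disjoint from the given
  one. For the second, the complement in \<open>X\<close> is lifted to an open \<open>V\<close>,
  which misses \<open>U\<close> by density.\<close>

lemma sc_trace_regular_neg:
  assumes X: "completely_regular_space X" and U: "openin (stone_cech X) U"
  shows "sc_trace X (regular_neg (stone_cech X) U) = regular_neg X (sc_trace X U)"
proof (rule subset_antisym)
  show "sc_trace X (regular_neg (stone_cech X) U) \<subseteq> regular_neg X (sc_trace X U)"
    using regular_neg_disjoint[of U "stone_cech X"]
    by (intro subset_regular_neg openin_sc_trace) (auto simp: sc_trace_def)
  obtain V where V: "openin (stone_cech X) V" "sc_trace X V = regular_neg X (sc_trace X U)"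
    using sc_trace_surj[OF X, of "regular_neg X (sc_trace X U)"] by auto
  then have "sc_trace X (V \<inter> U) = {}"
    using regular_neg_disjoint[of "sc_trace X U" X] by (auto simp: sc_trace_Int)
  then have "V \<inter> U = {}" using sc_trace_eq_empty_iff U V(1) by blast
  then have "V \<subseteq> regular_neg (stone_cech X) U" using V(1) by (rule subset_regular_neg[rotated])
  then show "regular_neg X (sc_trace X U) \<subseteq> sc_trace X (regular_neg (stone_cech X) U)"
    using V(2) by (auto simp: sc_trace_def)
qed

lemma sc_hat_regular_neg:
  assumes X: "completely_regular_space X" and A: "regular_open_in X A"
  shows "sc_hat X (regular_neg X A) = regular_neg (stone_cech X) (sc_hat X A)"
proof -
  have o: "openin (stone_cech X) (sc_hat X A)"
    using regular_open_in_sc_hat[OF X A] by (simp add: regular_open_in_def)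
  have "sc_trace X (regular_neg (stone_cech X) (sc_hat X A)) = regular_neg X A"
    by (simp add: sc_trace_regular_neg X o sc_trace_sc_hat A)
  then show ?thesis
    using sc_hat_sc_trace[OF X regular_open_in_neg[OF o]] A
      regular_open_in_neg[of X A] by (simp add: regular_open_in_def)
qed

lemma sc_hat_empty: "sc_hat X {} = {}" if "completely_regular_space X"
  using sc_hat_eq[OF that, of "{}"] by (simp add: regular_open_in_def)

lemma sc_hat_topspace: "sc_hat X (topspace X) = topspace (stone_cech X)" if "completely_regular_space X"
  using sc_hat_eq[OF that, of "topspace X"] by (simp add: regular_open_in_def stone_cech_dense)

text \<open>Replaces the hat by embedded points of \<open>X\<close>, on which the values of an
  extended map are known; naturality uses it in this form.\<close>

lemma closure_of_sc_hat:
  assumes X: "completely_regular_space X" and A: "regular_open_in X A"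
  shows "stone_cech X closure_of (sc_hat X A) = stone_cech X closure_of (sc_embed X ` A)"
  using closure_of_sc_trace[of X "sc_hat X A"] regular_open_in_sc_hat[OF X A] sc_trace_sc_hat[OF X A]
  by (simp add: regular_open_in_def)

section \<open>Extension of continuous maps\<close>

text \<open>Coordinate \<open>g\<close> of the image is coordinate \<open>g \<circ> \<phi>\<close>
  of the argument, so continuity is checked on coordinates. Since the embedded copy of
  \<open>X\<close> is dense, the image stays in the closure that defines
  \<open>stone_cech Y\<close>.\<close>

lemma continuous_extension_exists:
  assumes \<phi>: "continuous_map X Y \<phi>"
  obtains \<psi> where "\<psi> \<in> extensional (topspace (stone_cech X))"
    "continuous_map (stone_cech X) (stone_cech Y) \<psi>"
    "\<And>x. x \<in> topspace X \<Longrightarrow> \<psi> (sc_embed X x) = sc_embed Y (\<phi> x)"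
proof
  \<comment> \<open>Restricting the composite to \<open>topspace X\<close> makes it a legitimate
    index of the source cube.\<close>
  define c where "c g = (\<lambda>x\<in>topspace X. g (\<phi> x))" for g :: "'b \<Rightarrow> real"
  define \<psi> where "\<psi> = (\<lambda>z\<in>topspace (stone_cech X). \<lambda>g\<in>unit_functions Y. z (c g))"
  have c: "c g \<in> unit_functions X" if "g \<in> unit_functions Y" for g
  proof -
    have "continuous_map X (top_of_set {0..1}) (g \<circ> \<phi>)"
      using that \<phi> by (auto simp: unit_functions_def intro: continuous_map_compose)
    then have "continuous_map X (top_of_set {0..1}) (c g)"
      by (rule continuous_map_eq) (simp add: c_def)
    then show ?thesis by (simp add: unit_functions_def c_def)
  qed
  show "\<psi> \<in> extensional (topspace (stone_cech X))" by (simp add: \<psi>_def)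
  show e: "\<psi> (sc_embed X x) = sc_embed Y (\<phi> x)" if "x \<in> topspace X" for x
    using that sc_embed_image_subset[of X] c
    by (auto simp: \<psi>_def sc_embed_def c_def)
  have cont: "continuous_map (stone_cech X) (unit_cube Y) \<psi>"
    unfolding unit_cube_def continuous_map_componentwise
  proof (intro conjI ballI)
    show "\<psi> ` topspace (stone_cech X) \<subseteq> extensional (unit_functions Y)" by (auto simp: \<psi>_def)
    fix g assume g: "g \<in> unit_functions Y"
    show "continuous_map (stone_cech X) (top_of_set {0..1}) (\<lambda>z. \<psi> z g)"
      by (rule continuous_map_eq[OF continuous_map_stone_cech_projection[OF c[OF g]]])
        (simp add: \<psi>_def g)
  qed
  have "\<psi> ` topspace (stone_cech X) \<subseteq> unit_cube Y closure_of (\<psi> ` sc_embed X ` topspace X)"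
    using continuous_map_image_closure_subset[OF cont, of "sc_embed X ` topspace X"]
    by (simp add: stone_cech_dense)
  also have "\<dots> \<subseteq> topspace (stone_cech Y)"
    unfolding topspace_stone_cech
    using \<phi> e by (intro closure_of_mono) (auto simp: continuous_map_def)
  finally show "continuous_map (stone_cech X) (stone_cech Y) \<psi>"
    using cont by (simp add: stone_cech_def[of Y] topspace_stone_cech continuous_map_in_subtopology image_subset_iff_funcset)
qed

text \<open>Two continuous maps into a Hausdorff space that agree on a dense set are equal there,
  and extensionality fixes them elsewhere. So the description in \<open>sc_extend\<close> denotes
  the extension constructed above.\<close>

lemma sc_extend_spec:
  assumes \<phi>: "continuous_map X Y \<phi>"
  shows "continuous_map (stone_cech X) (stone_cech Y) (sc_extend X Y \<phi>)"
    and "x \<in> topspace X \<Longrightarrow> sc_extend X Y \<phi> (sc_embed X x) = sc_embed Y (\<phi> x)"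
proof -
  let ?P = "\<lambda>\<psi>. \<psi> \<in> extensional (topspace (stone_cech X)) \<and>
        continuous_map (stone_cech X) (stone_cech Y) \<psi> \<and>
        (\<forall>x\<in>topspace X. \<psi> (sc_embed X x) = sc_embed Y (\<phi> x))"
  obtain \<psi> where \<psi>: "?P \<psi>" using continuous_extension_exists[OF \<phi>] by metis
  have "?P (sc_extend X Y \<phi>)"
    unfolding sc_extend_def
  proof (rule theI[of ?P, OF \<psi>])
    fix \<psi>' assume \<psi>': "?P \<psi>'"
    have "\<psi>' z = \<psi> z" if "z \<in> topspace (stone_cech X)" for z
    proof (rule forall_in_closure_of_eq[where Y = "stone_cech Y" and f = \<psi>' and g = \<psi>])
      show "z \<in> stone_cech X closure_of (sc_embed X ` topspace X)"
        using that by (simp add: stone_cech_dense)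
      show "Hausdorff_space (stone_cech Y)" by (rule Hausdorff_space_stone_cech)
      show "continuous_map (stone_cech X) (stone_cech Y) \<psi>'" using \<psi>' by blast
      show "continuous_map (stone_cech X) (stone_cech Y) \<psi>" using \<psi> by blast
      show "\<psi>' w = \<psi> w" if "w \<in> sc_embed X ` topspace X" for w using that \<psi> \<psi>' by auto
    qed
    then show "\<psi>' = \<psi>"
      using \<psi> \<psi>' extensionalityI[of \<psi>' "topspace (stone_cech X)" \<psi>] by metis
  qed
  then show "continuous_map (stone_cech X) (stone_cech Y) (sc_extend X Y \<phi>)"
    and "x \<in> topspace X \<Longrightarrow> sc_extend X Y \<phi> (sc_embed X x) = sc_embed Y (\<phi> x)" by auto
qed

section \<open>Regular measures from contents on clopen algebras\<close>

text \<open>Finitely many base sets inside \<open>U\<close> cover the compact set \<open>K\<close>,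
  and an algebra contains their union. Uniqueness of the regular extension rests on this
  interpolation.\<close>

lemma inner_regular_on_open_by_base:
  assumes T: "compact_space T" and alg: "algebra (topspace T) \<A>"
    and base: "\<And>U x. openin T U \<Longrightarrow> x \<in> U \<Longrightarrow> \<exists>A\<in>\<A>. x \<in> A \<and> A \<subseteq> U"
    and op: "\<And>A. A \<in> \<A> \<Longrightarrow> openin T A"
    and U: "openin T U" and K: "closedin T K" "K \<subseteq> U"
  shows "\<exists>A\<in>\<A>. K \<subseteq> A \<and> A \<subseteq> U"
proof -
  interpret algebra "topspace T" \<A> by (rule alg)
  have "compactin T K" using T K closedin_compact_space by blast
  moreover have cover: "K \<subseteq> \<Union>{A\<in>\<A>. A \<subseteq> U}" using base[OF U] K(2) by blast
  ultimately obtain \<F> where \<F>: "finite \<F>" "\<F> \<subseteq> {A\<in>\<A>. A \<subseteq> U}" "K \<subseteq> \<Union>\<F>"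
    using compactinD[of T K "{A\<in>\<A>. A \<subseteq> U}"] cover op by auto
  then have "\<Union>\<F> \<in> \<A>" "\<Union>\<F> \<subseteq> U" by (auto intro: finite_Union)
  then show ?thesis using \<F>(3) by blast
qed

text \<open>The properties of the Stone space and its content from which the measure is built.
  Members of \<open>\<A>\<close> are clopen, because their complements are also members and hence
  open.\<close>

locale clopen_content =
  fixes T :: "'a topology" and \<A> :: "'a set set" and m :: "'a set \<Rightarrow> ennreal"
  assumes compact: "compact_space T"
    and alg: "algebra (topspace T) \<A>"
    and openin_alg: "A \<in> \<A> \<Longrightarrow> openin T A"
    and base: "openin T U \<Longrightarrow> x \<in> U \<Longrightarrow> \<exists>A\<in>\<A>. x \<in> A \<and> A \<subseteq> U"
    and pos: "positive \<A> m" and add: "additive \<A> m"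
    and total: "m (topspace T) = 1"
begin

interpretation algebra "topspace T" \<A> by (rule alg)

text \<open>The sigma-algebra generated by \<open>\<A>\<close> may be smaller than the Borel sets, so Caratheodory's
  extension of \<open>m\<close> does not suffice. Instead \<open>m\<close> is extended to open sets from inside and to all
  sets from outside; members of \<open>\<A>\<close> are compact, which makes the result countably subadditive.\<close>

definition open_msr :: "'a set \<Rightarrow> ennreal" where
  "open_msr U = (SUP A\<in>{A\<in>\<A>. A \<subseteq> U}. m A)"

definition outer_msr :: "'a set \<Rightarrow> ennreal" where
  "outer_msr E = (INF U\<in>{U. openin T U \<and> E \<subseteq> U}. open_msr U)"

lemma m_mono: "A \<in> \<A> \<Longrightarrow> B \<in> \<A> \<Longrightarrow> A \<subseteq> B \<Longrightarrow> m A \<le> m B"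
  using additive_increasing[OF pos add] by (simp add: increasing_def)

lemma open_msr_mono: "U \<subseteq> V \<Longrightarrow> open_msr U \<le> open_msr V"
  unfolding open_msr_def by (rule SUP_subset_mono) auto

lemma open_msr_alg: "A \<in> \<A> \<Longrightarrow> open_msr A = m A"
  unfolding open_msr_def by (rule antisym) (auto intro!: SUP_least SUP_upper m_mono)

lemma outer_msr_mono: "E \<subseteq> F \<Longrightarrow> outer_msr E \<le> outer_msr F"
  unfolding outer_msr_def by (rule INF_superset_mono) auto

lemma outer_msr_open: "openin T U \<Longrightarrow> outer_msr U = open_msr U"
  unfolding outer_msr_def by (rule antisym) (auto intro!: INF_lower INF_greatest open_msr_mono)

text \<open>A member of \<open>\<A>\<close> inside the union is compact, so finitely many base sets,
  each inside some \<open>U i\<close>, cover it. This reduces the claim to finite subadditivity of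
  \<open>m\<close>.\<close>

lemma open_msr_countably_subadditive:
  fixes U :: "nat \<Rightarrow> 'a set"
  assumes U: "\<And>i. openin T (U i)"
  shows "open_msr (\<Union>i. U i) \<le> (\<Sum>i. open_msr (U i))"
  unfolding open_msr_def[of "\<Union>i. U i"]
proof (rule SUP_least, clarsimp)
  fix A assume A: "A \<in> \<A>" "A \<subseteq> (\<Union>i. U i)"
  let ?\<C> = "{D\<in>\<A>. \<exists>i. D \<subseteq> U i}"
  have "closedin T A"
    using A(1) openin_alg[of "topspace T - A"] openin_alg[of A] compl_sets[of A]
    by (simp add: closedin_def openin_subset)
  then have "compactin T A" using compact closedin_compact_space by blast
  moreover have "A \<subseteq> \<Union>?\<C>"
  proof
    fix x assume "x \<in> A"
    then obtain i where "x \<in> U i" using A(2) by auto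
    then show "x \<in> \<Union>?\<C>" using base[OF U, of x i] by auto
  qed
  ultimately obtain \<F> where \<F>: "finite \<F>" "\<F> \<subseteq> ?\<C>" "A \<subseteq> \<Union>\<F>"
    using compactinD[of T A ?\<C>] openin_alg by auto
  then obtain i where i: "\<And>D. D \<in> \<F> \<Longrightarrow> D \<subseteq> U (i D)" by (simp add: subset_eq) metis
  \<comment> \<open>The finite subcover is grouped by the chosen index, giving one member of
    \<open>\<A>\<close> inside each \<open>U k\<close>.\<close>
  define E where "E k = \<Union>{D\<in>\<F>. i D = k}" for k
  have "E k \<in> \<A>" for k
    using \<F>(1,2) unfolding E_def by (intro finite_Union) auto
  moreover have "E k \<subseteq> U k" for k
    using i unfolding E_def by blast
  ultimately have E: "E k \<in> \<A>" "E k \<subseteq> U k" for k by auto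
  obtain n where n: "\<And>D. D \<in> \<F> \<Longrightarrow> i D < n"
    using \<F>(1) finite_nat_set_iff_bounded[of "i ` \<F>"] by auto
  have "A \<subseteq> (\<Union>k<n. E k)" using \<F>(3) n unfolding E_def by blast
  then have "m A \<le> m (\<Union>k<n. E k)" using A E by (intro m_mono finite_UN) auto
  also have "\<dots> \<le> (\<Sum>k<n. m (E k))" using E by (intro subadditive[OF pos add]) auto
  also have "\<dots> \<le> (\<Sum>k<n. open_msr (U k))"
    using E unfolding open_msr_def by (intro sum_mono SUP_upper) auto
  also have "\<dots> \<le> (\<Sum>i. open_msr (U i))" by (rule sum_le_suminf) auto
  finally show "m A \<le> (\<Sum>i. open_msr (U i))" .
qed

lemma outer_msr_empty: "outer_msr {} = 0"
  using outer_msr_open[of "{}"] open_msr_alg[of "{}"] pos by (simp add: positive_def)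

lemma outer_msr_approx:
  assumes "outer_msr E < c"
  obtains U where "openin T U" "E \<subseteq> U" "open_msr U < c"
  using assms unfolding outer_msr_def INF_less_iff by auto

lemma outer_measure_space_outer_msr: "outer_measure_space (Pow (topspace T)) outer_msr"
  unfolding outer_measure_space_def
proof (intro conjI)
  show "positive (Pow (topspace T)) outer_msr" by (simp add: positive_def outer_msr_empty)
  show "increasing (Pow (topspace T)) outer_msr" by (simp add: increasing_def outer_msr_mono)
  show "countably_subadditive (Pow (topspace T)) outer_msr"
    unfolding countably_subadditive_def
  proof (intro allI impI)
    fix A :: "nat \<Rightarrow> 'a set"
    show "outer_msr (\<Union>i. A i) \<le> (\<Sum>i. outer_msr (A i))"
    proof (rule ennreal_le_epsilon)
      fix e :: real assume e: "0 < e" and fin: "(\<Sum>i. outer_msr (A i)) < top"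
      \<comment> \<open>Finiteness of the sum makes every \<open>outer_msr (A n)\<close> finite, so
        adding a positive error is a strict increase. The errors add up to \<open>e\<close>.\<close>
      have "outer_msr (A n) < outer_msr (A n) + e * (1/2)^Suc n" for n
        using e fin by (auto simp add: less_top dest!: ennreal_suminf_lessD)
      then have "\<exists>U. openin T U \<and> A n \<subseteq> U \<and> open_msr U < outer_msr (A n) + e * (1/2)^Suc n" for n
        using outer_msr_approx by metis
      then obtain U where U: "\<And>n. openin T (U n)" "\<And>n. A n \<subseteq> U n"
          "\<And>n. open_msr (U n) < outer_msr (A n) + e * (1/2)^Suc n" by metis
      have "outer_msr (\<Union>i. A i) \<le> outer_msr (\<Union>i. U i)"
        using U(2) by (intro outer_msr_mono) blast
      also have "\<dots> = open_msr (\<Union>i. U i)" using U(1) by (intro outer_msr_open) auto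
      also have "\<dots> \<le> (\<Sum>i. open_msr (U i))" using U(1) by (rule open_msr_countably_subadditive)
      also have "\<dots> \<le> (\<Sum>n. outer_msr (A n) + e * (1/2) ^ Suc n)"
        using U(3) by (intro suminf_le less_imp_le) auto
      also have "\<dots> = (\<Sum>n. outer_msr (A n)) + (\<Sum>n. ennreal e * ennreal ((1/2) ^ Suc n))"
        using e by (subst suminf_add[symmetric])
          (auto simp del: ennreal_suminf_cmult simp add: ennreal_mult[symmetric])
      also have "\<dots> = (\<Sum>n. outer_msr (A n)) + e"
        unfolding ennreal_suminf_cmult
        by (subst suminf_ennreal_eq[OF zero_le_power power_half_series]) auto
      finally show "outer_msr (\<Union>i. A i) \<le> (\<Sum>n. outer_msr (A n)) + e" .
    qed
  qed
qed

lemma outer_msr_subadditive: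
  assumes "E \<subseteq> topspace T" "F \<subseteq> topspace T" "E \<inter> F = {}"
  shows "outer_msr (E \<union> F) \<le> outer_msr E + outer_msr F"
proof -
  let ?A = "\<lambda>n::nat. if n = 0 then E else if n = 1 then F else {}"
  have "(\<Union>n. ?A n) = E \<union> F" by (auto split: if_splits)
  moreover have "outer_msr (\<Union>n. ?A n) \<le> (\<Sum>n. outer_msr (?A n))"
    using outer_measure_space_outer_msr assms
    unfolding outer_measure_space_def countably_subadditive_def
    by (elim conjE allE[of _ ?A]) (auto simp: image_subset_iff disjoint_family_on_def split: if_splits)
  moreover have "(\<Sum>n. outer_msr (?A n)) = (\<Sum>n\<in>{0,1}. outer_msr (?A n))"
    by (rule suminf_finite) (auto simp: outer_msr_empty)
  ultimately show ?thesis by simp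
qed

text \<open>It suffices to test the splitting against open \<open>G\<close> containing
  \<open>E\<close>. The part \<open>G \<inter> U\<close> is exhausted from inside by some
  \<open>A\<close>, and what remains of \<open>E\<close> outside \<open>U\<close> is covered by the
  open set \<open>G - A\<close>, which is exhausted from inside by some \<open>B\<close>. As
  \<open>A\<close> and \<open>B\<close> are disjoint, additivity of \<open>m\<close> gives the
  bound.\<close>

lemma openin_in_lambda_system:
  assumes U: "openin T U"
  shows "U \<in> lambda_system (topspace T) (Pow (topspace T)) outer_msr"
proof -
  interpret P: sigma_algebra "topspace T" "Pow (topspace T)" by (rule sigma_algebra_Pow)
  have "outer_msr (E \<inter> U) + outer_msr (E - U) = outer_msr E" if E: "E \<subseteq> topspace T" for E
  proof (rule antisym)
    show "outer_msr E \<le> outer_msr (E \<inter> U) + outer_msr (E - U)"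
      using outer_msr_subadditive[of "E \<inter> U" "E - U"] E by (simp add: Int_Diff_Un Int_Diff_disjoint le_infI1 Diff_subset[THEN subset_trans])
    have "outer_msr (E \<inter> U) + outer_msr (E - U) \<le> open_msr G" if G: "openin T G" "E \<subseteq> G" for G
    proof -
      let ?I = "{A\<in>\<A>. A \<subseteq> G \<inter> U}"
      \<comment> \<open>The empty set is a member; nonemptiness allows an added constant to be moved
        out of the supremum.\<close>
      have ne: "?I \<noteq> {}" by auto
      have "m A + outer_msr (E - U) \<le> open_msr G" if A: "A \<in> \<A>" "A \<subseteq> G \<inter> U" for A
      proof -
        let ?J = "{B\<in>\<A>. B \<subseteq> G - A}"
        have "openin T (G - A)"
        proof -
          have "G - A = G \<inter> (topspace T - A)" using openin_subset[OF G(1)] by blast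
          then show ?thesis using G(1) A(1) compl_sets openin_alg by (metis openin_Int)
        qed
        moreover have "E - U \<subseteq> G - A" using G(2) A(2) by blast
        ultimately have "outer_msr (E - U) \<le> open_msr (G - A)"
          unfolding outer_msr_def by (intro INF_lower) auto
        then have "m A + outer_msr (E - U) \<le> (SUP B\<in>?J. m B) + m A"
          by (simp add: open_msr_def add.commute add_mono)
        also have "\<dots> = (SUP B\<in>?J. m B + m A)" by (rule ennreal_SUP_add_left[symmetric]) auto
        also have "\<dots> \<le> open_msr G"
        proof (rule SUP_least)
          fix B assume B: "B \<in> ?J"
          then have "m B + m A = m (B \<union> A)" using A add by (intro additiveD[symmetric]) auto
          also have "\<dots> \<le> open_msr G"
            using A B unfolding open_msr_def by (intro SUP_upper) auto
          finally show "m B + m A \<le> open_msr G" .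
        qed
        finally show ?thesis .
      qed
      then have "(SUP A\<in>?I. m A + outer_msr (E - U)) \<le> open_msr G" by (intro SUP_least) auto
      then have "open_msr (G \<inter> U) + outer_msr (E - U) \<le> open_msr G"
        unfolding open_msr_def[of "G \<inter> U"] ennreal_SUP_add_left[OF ne] .
      moreover have "outer_msr (E \<inter> U) \<le> open_msr (G \<inter> U)"
        unfolding outer_msr_def using G U by (intro INF_lower) auto
      ultimately show ?thesis using add_right_mono order_trans by blast
    qed
    then show "outer_msr (E \<inter> U) + outer_msr (E - U) \<le> outer_msr E"
      unfolding outer_msr_def[of E] by (intro INF_greatest) auto
  qed
  then show ?thesis using openin_subset[OF U] by (auto simp: P.lambda_system_eq)
qed

text \<open>The sets satisfying the Caratheodory condition form a sigma-algebra on which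
  \<open>outer_msr\<close> is a measure. It contains the open sets, hence all Borel sets.\<close>

lemma measure_space_outer_msr:
  "measure_space (topspace T) (sigma_sets (topspace T) {U. openin T U}) outer_msr"
proof -
  let ?L = "lambda_system (topspace T) (Pow (topspace T)) outer_msr"
  interpret P: sigma_algebra "topspace T" "Pow (topspace T)" by (rule sigma_algebra_Pow)
  have L: "measure_space (topspace T) ?L outer_msr"
    by (rule P.caratheodory_lemma[OF outer_measure_space_outer_msr])
  then have "sigma_algebra (topspace T) ?L" by (simp add: measure_space_def)
  then have "sigma_sets (topspace T) {U. openin T U} \<subseteq> ?L"
    using openin_in_lambda_system by (intro sigma_algebra.sigma_sets_subset) auto
  then show ?thesis
    by (intro measure_down[OF L] sigma_algebra_sigma_sets) (auto dest: openin_subset)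
qed

text \<open>Outer regularity is built into \<open>outer_msr\<close>; inner regularity follows from
  it by taking complements in a space of total mass 1.\<close>

lemma regular_extension_exists:
  "\<exists>M. normal_borel_prob T M \<and> (\<forall>A\<in>\<A>. emeasure M A = m A)"
proof -
  let ?S = "sigma_sets (topspace T) {U. openin T U}"
  define M where "M = measure_of (topspace T) ?S outer_msr"
  have sa: "sigma_algebra (topspace T) ?S" and ms: "positive ?S outer_msr" "countably_additive ?S outer_msr"
    using measure_space_outer_msr by (auto simp: measure_space_def)
  have S: "?S \<subseteq> Pow (topspace T)" using sa by (simp add: sigma_algebra_iff2)
  have sp: "space M = topspace T" and se: "sets M = ?S"
    using S sigma_algebra.sigma_sets_eq[OF sa]
    by (simp_all add: M_def space_measure_of_conv sets_measure_of)
  have em: "emeasure M E = outer_msr E" if "E \<in> sets M" for E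
    unfolding M_def using that sa ms by (intro emeasure_measure_of_sigma) (auto simp: se)
  have op: "U \<in> sets M" if "openin T U" for U using that by (auto simp: se)
  have emo: "emeasure M U = open_msr U" if "openin T U" for U
    using that em op outer_msr_open by simp
  have "emeasure M (topspace T) = 1" using emo[of "topspace T"] total by (simp add: open_msr_alg)
  then have pr: "prob_space M" by (intro prob_spaceI) (simp add: sp)
  interpret prob_space M by (rule pr)
  have outer: "emeasure M E = (INF U\<in>{U. openin T U \<and> E \<subseteq> U}. emeasure M U)" if E: "E \<in> sets M" for E
    unfolding em[OF E] outer_msr_def by (intro INF_cong refl) (simp add: emo)
  have inner: "emeasure M E = (SUP K\<in>{K. closedin T K \<and> K \<subseteq> E}. emeasure M K)" if E: "E \<in> sets M" for E
  proof (rule antisym)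
    have cl: "K \<in> sets M" if "closedin T K" for K
    proof -
      have "space M - (topspace T - K) \<in> sets M"
        using that op[of "topspace T - K"] by (intro sets.compl_sets) auto
      then show ?thesis using closedin_subset[OF that] by (simp add: sp double_diff)
    qed
    then show "(SUP K\<in>{K. closedin T K \<and> K \<subseteq> E}. emeasure M K) \<le> emeasure M E"
      using E by (intro SUP_least emeasure_mono) auto
    let ?I = "{U. openin T U \<and> space M - E \<subseteq> U}"
    have ne: "?I \<noteq> {}" using sp by auto
    \<comment> \<open>Open sets around the complement of \<open>E\<close> turn into closed sets
      inside \<open>E\<close>.\<close>
    have "emeasure M E = emeasure M (space M - (space M - E))"
      using sets.sets_into_space[OF E] by (simp add: double_diff)
    also have "\<dots> = emeasure M (space M) - emeasure M (space M - E)"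
      using E by (intro emeasure_compl) auto
    also have "\<dots> = emeasure M (space M) - (INF U\<in>?I. emeasure M U)"
      using outer[of "space M - E"] E by auto
    also have "\<dots> = (SUP U\<in>?I. emeasure M (space M) - emeasure M U)"
      by (rule ennreal_INF_const_minus[OF ne, symmetric])
    also have "\<dots> \<le> (SUP K\<in>{K. closedin T K \<and> K \<subseteq> E}. emeasure M K)"
    proof (rule SUP_least)
      fix U assume U: "U \<in> ?I"
      then have "emeasure M (space M) - emeasure M U = emeasure M (space M - U)"
        using op by (intro emeasure_compl[symmetric]) auto
      also have "\<dots> \<le> (SUP K\<in>{K. closedin T K \<and> K \<subseteq> E}. emeasure M K)"
        using U by (intro SUP_upper) (auto simp: sp)
      finally show "emeasure M (space M) - emeasure M U \<le> \<dots>" .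
    qed
    finally show "emeasure M E \<le> (SUP K\<in>{K. closedin T K \<and> K \<subseteq> E}. emeasure M K)" .
  qed
  have "\<forall>A\<in>\<A>. emeasure M A = m A" using emo openin_alg open_msr_alg by auto
  then show ?thesis using pr se outer inner unfolding normal_borel_prob_def by blast
qed

text \<open>Inner regularity and interpolation by members of \<open>\<A>\<close> force the value
  \<open>open_msr\<close> on open sets; outer regularity then determines the rest.\<close>

lemma regular_extension_unique:
  assumes M: "normal_borel_prob T M" "\<forall>A\<in>\<A>. emeasure M A = m A"
    and N: "normal_borel_prob T N" "\<forall>A\<in>\<A>. emeasure N A = m A"
  shows "M = N"
proof -
  have open_eq: "emeasure M U = open_msr U"
    if M: "normal_borel_prob T M" "\<forall>A\<in>\<A>. emeasure M A = m A" and U: "openin T U" for M U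
  proof (rule antisym)
    have se: "sets M = sigma_sets (topspace T) {U. openin T U}"
      using M(1) by (simp add: normal_borel_prob_def)
    then have Us: "V \<in> sets M" if "openin T V" for V using that by auto
    have "emeasure M U = (SUP K\<in>{K. closedin T K \<and> K \<subseteq> U}. emeasure M K)"
      using M(1) Us[OF U] unfolding normal_borel_prob_def by blast
    also have "\<dots> \<le> open_msr U"
    proof (rule SUP_least)
      fix K assume "K \<in> {K. closedin T K \<and> K \<subseteq> U}"
      then obtain A where A: "A \<in> \<A>" "K \<subseteq> A" "A \<subseteq> U"
        using inner_regular_on_open_by_base[OF compact alg base openin_alg U, of K] by auto
      then have "emeasure M K \<le> m A"
        using M(2) emeasure_mono[of K A M] Us[OF openin_alg] by auto
      also have "\<dots> \<le> open_msr U" using A unfolding open_msr_def by (intro SUP_upper) auto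
      finally show "emeasure M K \<le> open_msr U" .
    qed
    finally show "emeasure M U \<le> open_msr U" .
    show "open_msr U \<le> emeasure M U"
      unfolding open_msr_def
    proof (rule SUP_least)
      fix A assume "A \<in> {A\<in>\<A>. A \<subseteq> U}"
      then show "m A \<le> emeasure M U" using M(2) emeasure_mono[of A U M] Us[OF U] by auto
    qed
  qed
  have se: "sets M = sets N" using M(1) N(1) by (simp add: normal_borel_prob_def)
  show ?thesis
  proof (rule measure_eqI[OF se])
    fix E assume E: "E \<in> sets M"
    have "emeasure M E = (INF U\<in>{U. openin T U \<and> E \<subseteq> U}. emeasure M U)"
      using M(1) E unfolding normal_borel_prob_def by blast
    also have "\<dots> = (INF U\<in>{U. openin T U \<and> E \<subseteq> U}. emeasure N U)"
      by (intro INF_cong refl) (simp add: open_eq[OF M] open_eq[OF N])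
    also have "\<dots> = emeasure N E"
      using N(1) E se unfolding normal_borel_prob_def by metis
    finally show "emeasure M E = emeasure N E" .
  qed
qed

end

section \<open>The Stone space of an algebra of regular open sets\<close>

lemma ultrafilter_ofD:
  assumes "ultrafilter_of X \<BB> s"
  shows "Q \<in> s \<Longrightarrow> Q \<in> \<BB>" "topspace X \<in> s" "{} \<notin> s"
    "Q \<in> s \<Longrightarrow> R \<in> s \<Longrightarrow> Q \<inter> R \<in> s"
    "Q \<in> s \<Longrightarrow> R \<in> \<BB> \<Longrightarrow> Q \<subseteq> R \<Longrightarrow> R \<in> s"
    "R \<in> \<BB> \<Longrightarrow> R \<notin> s \<Longrightarrow> regular_neg X R \<in> s"
  using assms unfolding ultrafilter_of_def by blast+

lemma ultrafilter_of_regular_neg_iff: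
  assumes s: "ultrafilter_of X \<BB> s" and R: "R \<in> \<BB>"
  shows "regular_neg X R \<in> s \<longleftrightarrow> R \<notin> s"
proof -
  have False if "R \<in> s" "regular_neg X R \<in> s"
    using ultrafilter_ofD(3,4)[OF s] that regular_neg_disjoint[of R X] by metis
  then show ?thesis using ultrafilter_ofD(6)[OF s R] by blast
qed

text \<open>The factor \<open>topspace X\<close> gives the right value for empty \<open>G\<close>,
  whose intersection is \<open>UNIV\<close>.\<close>

lemma ultrafilter_of_Inter:
  assumes s: "ultrafilter_of X \<BB> s" and G: "finite G" "G \<subseteq> s"
  shows "topspace X \<inter> \<Inter>G \<in> s"
  using G
proof (induction G)
  case empty
  then show ?case using ultrafilter_ofD(2)[OF s] by simp
next
  case (insert A G)
  have "topspace X \<inter> \<Inter>(insert A G) = A \<inter> (topspace X \<inter> \<Inter>G)" by auto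
  then show ?case using insert ultrafilter_ofD(4)[OF s] by auto
qed

locale regular_algebra =
  fixes X :: "'a topology" and \<BB> :: "'a set set"
  assumes boolean: "boolean_subalgebra X \<BB>"
begin

lemma regular [simp]: "A \<in> \<BB> \<Longrightarrow> regular_open_in X A"
  and topspace_mem [simp]: "topspace X \<in> \<BB>"
  and Int_mem [simp]: "A \<in> \<BB> \<Longrightarrow> B \<in> \<BB> \<Longrightarrow> A \<inter> B \<in> \<BB>"
  and join_mem: "A \<in> \<BB> \<Longrightarrow> B \<in> \<BB> \<Longrightarrow> regular_join X A B \<in> \<BB>"
  and neg_mem [simp]: "A \<in> \<BB> \<Longrightarrow> regular_neg X A \<in> \<BB>"
  using boolean by (auto simp: boolean_subalgebra_def)

lemma openin_mem: "A \<in> \<BB> \<Longrightarrow> openin X A"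
  using regular by (auto simp: regular_open_in_def)

lemma empty_mem [simp]: "{} \<in> \<BB>"
  using neg_mem[OF topspace_mem] by (simp add: regular_neg_def)

text \<open>Zorn's lemma yields a maximal subset of \<open>\<BB>\<close> with the finite
  intersection property, and maximality makes it an ultrafilter.\<close>

lemma ultrafilter_extends:
  assumes F: "F \<subseteq> \<BB>" and fip: "\<And>G. finite G \<Longrightarrow> G \<subseteq> F \<Longrightarrow> topspace X \<inter> \<Inter>G \<noteq> {}"
  obtains s where "ultrafilter_of X \<BB> s" "F \<subseteq> s"
proof -
  define fip where "fip M \<longleftrightarrow> (\<forall>G. finite G \<and> G \<subseteq> M \<longrightarrow> topspace X \<inter> \<Inter>G \<noteq> {})" for M
  define \<W> where "\<W> = {M. F \<subseteq> M \<and> M \<subseteq> \<BB> \<and> fip M}"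
  have "F \<in> \<W>" using F assms(2) by (auto simp: \<W>_def fip_def)
  have "\<exists>M\<in>\<W>. \<forall>N\<in>\<W>. M \<subseteq> N \<longrightarrow> N = M"
  proof (rule subset_Zorn_nonempty)
    show "\<W> \<noteq> {}" using \<open>F \<in> \<W>\<close> by blast
    fix \<C> assume \<C>: "\<C> \<noteq> {}" "subset.chain \<W> \<C>"
    then have "\<C> \<subseteq> \<W>" by (simp add: subset_chain_def)
    moreover have "fip (\<Union>\<C>)"
      unfolding fip_def
    proof (intro allI impI)
      fix G assume "finite G \<and> G \<subseteq> \<Union>\<C>"
      then obtain M where "M \<in> \<C>" "G \<subseteq> M" using finite_subset_Union_chain \<C> by metis
      then show "topspace X \<inter> \<Inter>G \<noteq> {}"
        using \<open>\<C> \<subseteq> \<W>\<close> \<open>finite G \<and> G \<subseteq> \<Union>\<C>\<close> by (auto simp: \<W>_def fip_def)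
    qed
    ultimately show "\<Union>\<C> \<in> \<W>" using \<C>(1) unfolding \<W>_def by blast
  qed
  then obtain M where M: "M \<in> \<W>" and max: "\<And>N. N \<in> \<W> \<Longrightarrow> M \<subseteq> N \<Longrightarrow> N = M" by metis
  from M have M: "F \<subseteq> M" "M \<subseteq> \<BB>" "fip M" by (auto simp: \<W>_def)
  have fipM: "topspace X \<inter> \<Inter>G \<noteq> {}" if "finite G" "G \<subseteq> M" for G
    using M(3) that by (simp add: fip_def)
  \<comment> \<open>Maximality in usable form: an element left out is already disjoint from a finite
    intersection of members.\<close>
  have out: "\<exists>G. finite G \<and> G \<subseteq> M \<and> topspace X \<inter> \<Inter>G \<inter> R = {}" if R: "R \<in> \<BB>" "R \<notin> M" for R
  proof -
    have "\<not> fip (insert R M)" using max[of "insert R M"] M R by (auto simp: \<W>_def)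
    then obtain G where G: "finite G" "G \<subseteq> insert R M" "topspace X \<inter> \<Inter>G = {}"
      unfolding fip_def by blast
    have "topspace X \<inter> \<Inter>(G - {R}) \<inter> R \<subseteq> topspace X \<inter> \<Inter>G" by blast
    then have "topspace X \<inter> \<Inter>(G - {R}) \<inter> R = {}" using G(3) by simp
    then show ?thesis using G by (intro exI[of _ "G - {R}"]) auto
  qed
  have "ultrafilter_of X \<BB> M"
    unfolding ultrafilter_of_def
  proof (intro conjI ballI impI)
    show "M \<subseteq> \<BB>" by (rule M)
    show "topspace X \<in> M"
    proof (rule ccontr)
      assume "topspace X \<notin> M"
      then obtain G where G: "finite G" "G \<subseteq> M" "topspace X \<inter> \<Inter>G \<inter> topspace X = {}"
        using out[of "topspace X"] by auto
      then show False using fipM[of G] by blast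
    qed
    show "{} \<notin> M" using fipM[of "{{}}"] by auto
    show "Q \<inter> R \<in> M" if QR: "Q \<in> M" "R \<in> M" for Q R
    proof (rule ccontr)
      assume n: "Q \<inter> R \<notin> M"
      have "Q \<inter> R \<in> \<BB>" using M(2) QR by (intro Int_mem) auto
      then obtain G where G: "finite G" "G \<subseteq> M" "topspace X \<inter> \<Inter>G \<inter> (Q \<inter> R) = {}"
        using out[OF _ n] by metis
      then have "topspace X \<inter> \<Inter>(G \<union> {Q, R}) = {}" by auto
      then show False using fipM[of "G \<union> {Q, R}"] QR G(1,2) by simp
    qed
    show "R \<in> M" if QR: "Q \<in> M" "R \<in> \<BB>" "Q \<subseteq> R" for Q R
    proof (rule ccontr)
      assume "R \<notin> M"
      then obtain G where G: "finite G" "G \<subseteq> M" "topspace X \<inter> \<Inter>G \<inter> R = {}"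
        using out[of R] QR by auto
      then have "topspace X \<inter> \<Inter>(insert Q G) = {}" using QR(3) by auto
      then show False using fipM[of "insert Q G"] QR G(1,2) by simp
    qed
    show "R \<in> M \<or> regular_neg X R \<in> M" if R: "R \<in> \<BB>" for R
    proof (rule ccontr)
      assume n: "\<not> (R \<in> M \<or> regular_neg X R \<in> M)"
      obtain G where G: "finite G" "G \<subseteq> M" "topspace X \<inter> \<Inter>G \<inter> R = {}"
        using out[of R] n R by auto
      obtain H where H: "finite H" "H \<subseteq> M" "topspace X \<inter> \<Inter>H \<inter> regular_neg X R = {}"
        using out[of "regular_neg X R"] n R by auto
      \<comment> \<open>The joint finite intersection is open and misses \<open>R\<close>, so it
        lies in the complement of \<open>R\<close>; it misses that as well and is therefore
        empty.\<close>
      have "openin X (topspace X \<inter> \<Inter>(G \<union> H))"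
        using G H M(2) openin_mem by (intro openin_Int_Inter) auto
      then have "topspace X \<inter> \<Inter>(G \<union> H) \<subseteq> regular_neg X R"
        using G by (intro subset_regular_neg) auto
      then have "topspace X \<inter> \<Inter>(G \<union> H) = {}" using H by blast
      then show False using fipM[of "G \<union> H"] G H by auto
    qed
  qed
  with M(1) show ?thesis by (rule that[rotated])
qed

lemma topspace_stone: "topspace (stone_space X \<BB>) = {s. ultrafilter_of X \<BB> s}"
  unfolding stone_space_def topology_generated_by_topspace
  using topspace_mem by (auto simp: stone_clopen_def ultrafilter_of_def)

lemma stone_clopen_Int: "A \<in> \<BB> \<Longrightarrow> B \<in> \<BB> \<Longrightarrow> stone_clopen X \<BB> (A \<inter> B) = stone_clopen X \<BB> A \<inter> stone_clopen X \<BB> B"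
  by (auto simp: stone_clopen_def ultrafilter_ofD(4) intro: ultrafilter_ofD(5))

lemma stone_clopen_neg: "A \<in> \<BB> \<Longrightarrow> stone_clopen X \<BB> (regular_neg X A) = topspace (stone_space X \<BB>) - stone_clopen X \<BB> A"
  by (auto simp: stone_clopen_def topspace_stone ultrafilter_of_regular_neg_iff)

lemma stone_clopen_join:
  assumes "A \<in> \<BB>" "B \<in> \<BB>"
  shows "stone_clopen X \<BB> (regular_join X A B) = stone_clopen X \<BB> A \<union> stone_clopen X \<BB> B"
proof -
  have "stone_clopen X \<BB> D \<subseteq> topspace (stone_space X \<BB>)" for D
    by (auto simp: stone_clopen_def topspace_stone)
  then show ?thesis using assms
    by (auto simp: regular_join_eq_neg stone_clopen_neg stone_clopen_Int)
qed

lemma stone_clopen_topspace: "stone_clopen X \<BB> (topspace X) = topspace (stone_space X \<BB>)"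
  by (auto simp: stone_clopen_def topspace_stone ultrafilter_ofD(2))

lemma stone_clopen_empty: "stone_clopen X \<BB> {} = {}"
  by (auto simp: stone_clopen_def ultrafilter_ofD(3))

lemma openin_stone_clopen: "A \<in> \<BB> \<Longrightarrow> openin (stone_space X \<BB>) (stone_clopen X \<BB> A)"
  unfolding stone_space_def by (rule topology_generated_by_Basis) auto

text \<open>The generating family is a priori only a subbase; closure under intersections turns it
  into a base.\<close>

lemma stone_base:
  assumes "openin (stone_space X \<BB>) U" "s \<in> U"
  shows "\<exists>A\<in>\<BB>. s \<in> stone_clopen X \<BB> A \<and> stone_clopen X \<BB> A \<subseteq> U"
proof -
  have "generate_topology_on (stone_clopen X \<BB> ` \<BB>) U"
    using assms(1) unfolding stone_space_def by (rule openin_topology_generated_by)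
  then show ?thesis using assms(2)
  proof (induction U)
    case (Int U V)
    then obtain A B where "A \<in> \<BB>" "s \<in> stone_clopen X \<BB> A" "stone_clopen X \<BB> A \<subseteq> U"
      "B \<in> \<BB>" "s \<in> stone_clopen X \<BB> B" "stone_clopen X \<BB> B \<subseteq> V" by blast
    then show ?case by (intro bexI[of _ "A \<inter> B"]) (auto simp: stone_clopen_Int)
  next
    case (UN K)
    then show ?case by (meson UnionE Union_upper subset_trans)
  qed auto
qed

text \<open>If \<open>A\<close> is not inside \<open>B\<close>, then \<open>A\<close> meets the
  complement of \<open>B\<close>, and an ultrafilter containing this intersection separates the two
  clopen sets.\<close>

lemma stone_clopen_subset_iff:
  assumes "A \<in> \<BB>" "B \<in> \<BB>"
  shows "stone_clopen X \<BB> A \<subseteq> stone_clopen X \<BB> B \<longleftrightarrow> A \<subseteq> B"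
proof
  assume sub: "stone_clopen X \<BB> A \<subseteq> stone_clopen X \<BB> B"
  show "A \<subseteq> B"
  proof (rule ccontr)
    assume "\<not> A \<subseteq> B"
    then have ne: "A \<inter> regular_neg X B \<noteq> {}"
      using assms openin_mem regular subset_if_disjoint_regular_neg by blast
    let ?F = "{A \<inter> regular_neg X B}"
    have "topspace X \<inter> \<Inter>G \<noteq> {}" if "finite G" "G \<subseteq> ?F" for G
    proof -
      have "A \<inter> regular_neg X B \<subseteq> topspace X \<inter> \<Inter>G"
        using that openin_subset[OF openin_mem[OF assms(1)]] by blast
      then show ?thesis using ne by blast
    qed
    moreover have "?F \<subseteq> \<BB>" using assms by simp
    ultimately obtain s where s: "ultrafilter_of X \<BB> s" "?F \<subseteq> s"
      using ultrafilter_extends[of ?F] by metis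
    then have "A \<inter> regular_neg X B \<in> s" by simp
    then have "A \<in> s" "regular_neg X B \<in> s"
      using ultrafilter_ofD(5)[OF s(1)] assms by (meson Int_lower1 Int_lower2 neg_mem)+
    then show False using sub s assms by (auto simp: stone_clopen_def ultrafilter_of_regular_neg_iff)
  qed
qed (auto simp: stone_clopen_def assms intro: ultrafilter_ofD(5))

lemma inj_on_stone_clopen: "inj_on (stone_clopen X \<BB>) \<BB>"
  by (rule inj_onI) (simp add: stone_clopen_subset_iff set_eq_subset)

text \<open>Take the complements of all elements whose clopen set lies in some member of the cover.
  Without a finite subcover they have the finite intersection property, and an ultrafilter
  containing them all could lie in no member of the cover.\<close>

lemma compact_space_stone: "compact_space (stone_space X \<BB>)"
  unfolding compact_space_alt
proof (intro allI impI, elim conjE, rule ccontr)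
  fix \<U> assume \<U>: "\<forall>U\<in>\<U>. openin (stone_space X \<BB>) U" "topspace (stone_space X \<BB>) \<subseteq> \<Union>\<U>"
    and no: "\<nexists>\<F>. finite \<F> \<and> \<F> \<subseteq> \<U> \<and> topspace (stone_space X \<BB>) \<subseteq> \<Union>\<F>"
  define D where "D = {B\<in>\<BB>. \<exists>U\<in>\<U>. stone_clopen X \<BB> B \<subseteq> U}"
  have "topspace X \<inter> \<Inter>G \<noteq> {}" if G: "finite G" "G \<subseteq> regular_neg X ` D" for G
  proof
    assume e: "topspace X \<inter> \<Inter>G = {}"
    obtain H where H: "finite H" "H \<subseteq> D" "G = regular_neg X ` H"
      using finite_subset_image[OF G] by blast
    obtain u where u: "\<And>B. B \<in> H \<Longrightarrow> u B \<in> \<U> \<and> stone_clopen X \<BB> B \<subseteq> u B"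
      using H(2) unfolding D_def by (simp add: subset_eq) metis
    have "s \<in> \<Union>(u ` H)" if s: "ultrafilter_of X \<BB> s" for s
    proof -
      have "\<not> G \<subseteq> s" using ultrafilter_of_Inter[OF s G(1)] e ultrafilter_ofD(3)[OF s] by auto
      then obtain B where "B \<in> H" "regular_neg X B \<notin> s" using H by auto
      moreover then have "B \<in> \<BB>" using H unfolding D_def by auto
      ultimately show ?thesis using u[of B] s
        by (auto simp: ultrafilter_of_regular_neg_iff stone_clopen_def)
    qed
    then show False using no H(1) u by (auto simp: topspace_stone dest!: spec[of _ "u ` H"])
  qed
  moreover have "regular_neg X ` D \<subseteq> \<BB>" unfolding D_def by auto
  ultimately obtain s where s: "ultrafilter_of X \<BB> s" "regular_neg X ` D \<subseteq> s"
    using ultrafilter_extends by metis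
  then obtain U where U: "U \<in> \<U>" "s \<in> U" using \<U>(2) by (auto simp: topspace_stone)
  then obtain A where A: "A \<in> \<BB>" "s \<in> stone_clopen X \<BB> A" "stone_clopen X \<BB> A \<subseteq> U"
    using stone_base \<U>(1) by blast
  then have "A \<in> D" using U unfolding D_def by auto
  then have "regular_neg X A \<in> s" using s by blast
  then show False using A s by (simp add: ultrafilter_of_regular_neg_iff stone_clopen_def)
qed

lemma Hausdorff_space_stone: "Hausdorff_space (stone_space X \<BB>)"
  unfolding Hausdorff_space_def
proof (intro allI impI)
  fix s t assume "s \<in> topspace (stone_space X \<BB>) \<and> t \<in> topspace (stone_space X \<BB>) \<and> s \<noteq> t"
  then have s: "ultrafilter_of X \<BB> s" and t: "ultrafilter_of X \<BB> t" and "s \<noteq> t"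
    by (auto simp: topspace_stone)
  \<comment> \<open>An ultrafilter contained in another one equals it, so distinct ultrafilters
    differ in this direction too.\<close>
  have "\<exists>A\<in>s. A \<notin> t"
  proof (rule ccontr)
    assume "\<not> (\<exists>A\<in>s. A \<notin> t)"
    then have st: "s \<subseteq> t" by blast
    have "A \<in> s" if A: "A \<in> t" for A
    proof (rule ccontr)
      have AB: "A \<in> \<BB>" using ultrafilter_ofD(1)[OF t A] .
      assume "A \<notin> s"
      then have "regular_neg X A \<in> t" using ultrafilter_ofD(6)[OF s AB] st by blast
      then show False using A by (simp add: ultrafilter_of_regular_neg_iff[OF t AB])
    qed
    then show False using st \<open>s \<noteq> t\<close> by blast
  qed
  then obtain A where A: "A \<in> s" "A \<notin> t" by blast
  then have AB: "A \<in> \<BB>" using ultrafilter_ofD(1)[OF s] by blast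
  have "regular_neg X A \<in> t" using ultrafilter_ofD(6)[OF t AB A(2)] .
  show "\<exists>U V. openin (stone_space X \<BB>) U \<and> openin (stone_space X \<BB>) V \<and> s \<in> U \<and> t \<in> V \<and> disjnt U V"
  proof (intro exI conjI)
    show "openin (stone_space X \<BB>) (stone_clopen X \<BB> A)"
      "openin (stone_space X \<BB>) (stone_clopen X \<BB> (regular_neg X A))"
      using AB by (simp_all add: openin_stone_clopen)
    show "s \<in> stone_clopen X \<BB> A" using s A by (simp add: stone_clopen_def)
    show "t \<in> stone_clopen X \<BB> (regular_neg X A)"
      using t \<open>regular_neg X A \<in> t\<close> by (simp add: stone_clopen_def)
    show "disjnt (stone_clopen X \<BB> A) (stone_clopen X \<BB> (regular_neg X A))"
      using AB by (simp add: stone_clopen_neg disjnt_def)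
  qed
qed

lemma algebra_stone_clopen: "algebra (topspace (stone_space X \<BB>)) (stone_clopen X \<BB> ` \<BB>)"
  unfolding algebra_iff_Un
proof (intro conjI ballI)
  show "stone_clopen X \<BB> ` \<BB> \<subseteq> Pow (topspace (stone_space X \<BB>))"
    by (auto simp: stone_clopen_def topspace_stone)
  show "{} \<in> stone_clopen X \<BB> ` \<BB>" using stone_clopen_empty empty_mem by (metis image_eqI)
  fix a assume a: "a \<in> stone_clopen X \<BB> ` \<BB>"
  then show "topspace (stone_space X \<BB>) - a \<in> stone_clopen X \<BB> ` \<BB>"
    by (auto simp flip: stone_clopen_neg)
  fix b assume "b \<in> stone_clopen X \<BB> ` \<BB>"
  with a show "a \<union> b \<in> stone_clopen X \<BB> ` \<BB>"
    by (auto simp flip: stone_clopen_join intro!: imageI join_mem)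
qed

section \<open>Transfer of the content to the clopen sets of the Stone space\<close>

lemma content_join:
  assumes \<mu>: "content_on X \<BB> \<mu>" and AB: "A \<in> \<BB>" "B \<in> \<BB>" "A \<inter> B = {}"
  shows "\<mu> (regular_join X A B) = \<mu> A + \<mu> B"
proof -
  let ?f = "\<lambda>n::nat. if n = 0 then A else B"
  have "\<mu> (regular_Join X 2 ?f) = (\<Sum>n<2. \<mu> (?f n))"
  proof (rule \<mu>[unfolded content_on_def, THEN conjunct2, rule_format], intro conjI allI impI)
    show "?f n \<in> \<BB>" for n using AB by simp
    show "disjoint_family_on ?f {..<2}"
      using AB(3) by (auto simp: disjoint_family_on_def less_2_cases_iff)
  qed
  moreover have "(\<Union>n<2. ?f n) = A \<union> B" by (auto simp: less_2_cases_iff)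
  moreover have "(\<Sum>n<2. \<mu> (?f n)) = \<mu> A + \<mu> B" by (simp add: numeral_2_eq_2)
  ultimately show ?thesis by (simp only: regular_Join_def regular_join_def)
qed

text \<open>Additivity for the empty family, whose join is the empty set.\<close>

lemma content_empty: "content_on X \<BB> \<mu> \<Longrightarrow> \<mu> {} = 0"
  unfolding content_on_def
  by (auto simp: regular_Join_def disjoint_family_on_def dest!: conjunct2 spec[of _ 0])

text \<open>The element behind a clopen set is recovered by \<open>inv_into\<close>, unambiguously
  by injectivity. Disjoint clopen sets come from disjoint elements and their union from the join, so
  additivity carries over.\<close>

lemma clopen_content_stone:
  assumes \<mu>: "content_on X \<BB> \<mu>" and total: "\<mu> (topspace X) = 1"
  shows "clopen_content (stone_space X \<BB>) (stone_clopen X \<BB> ` \<BB>)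
    (\<lambda>U. ennreal (\<mu> (inv_into \<BB> (stone_clopen X \<BB>) U)))"
proof (rule clopen_content.intro)
  let ?m = "\<lambda>U. ennreal (\<mu> (inv_into \<BB> (stone_clopen X \<BB>) U))"
  have m: "?m (stone_clopen X \<BB> A) = ennreal (\<mu> A)" if "A \<in> \<BB>" for A
    by (simp add: that inj_on_stone_clopen)
  show "compact_space (stone_space X \<BB>)" by (rule compact_space_stone)
  show "algebra (topspace (stone_space X \<BB>)) (stone_clopen X \<BB> ` \<BB>)" by (rule algebra_stone_clopen)
  show "openin (stone_space X \<BB>) A" if "A \<in> stone_clopen X \<BB> ` \<BB>" for A
    using that openin_stone_clopen by auto
  show "\<exists>A\<in>stone_clopen X \<BB> ` \<BB>. x \<in> A \<and> A \<subseteq> U" if "openin (stone_space X \<BB>) U" "x \<in> U" for U x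
    using stone_base[OF that] by blast
  show "positive (stone_clopen X \<BB> ` \<BB>) ?m"
    using m[of "{}"] content_empty[OF \<mu>] by (simp add: positive_def stone_clopen_empty)
  show "additive (stone_clopen X \<BB> ` \<BB>) ?m"
    unfolding Measure_Space.additive_def
  proof (intro ballI impI)
    fix a b assume "a \<in> stone_clopen X \<BB> ` \<BB>" "b \<in> stone_clopen X \<BB> ` \<BB>" and dis: "a \<inter> b = {}"
    then obtain A B where AB: "A \<in> \<BB>" "B \<in> \<BB>" "a = stone_clopen X \<BB> A" "b = stone_clopen X \<BB> B"
      by blast
    then have "stone_clopen X \<BB> (A \<inter> B) \<subseteq> stone_clopen X \<BB> {}"
      using dis by (simp add: stone_clopen_Int)
    then have "A \<inter> B = {}" using AB by (subst (asm) stone_clopen_subset_iff) auto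
    then have "\<mu> (regular_join X A B) = \<mu> A + \<mu> B" using AB by (intro content_join[OF \<mu>])
    then show "?m (a \<union> b) = ?m a + ?m b"
      using AB \<mu> m by (simp flip: stone_clopen_join add: join_mem content_on_def)
  qed
  show "?m (topspace (stone_space X \<BB>)) = 1"
    using m[of "topspace X"] total by (simp add: stone_clopen_topspace)
qed

end

text \<open>The definition prescribes real values of \<open>measure\<close>, the locale extended
  values of \<open>emeasure\<close>. For a probability measure and a nonnegative content the two
  conditions agree, so existence and uniqueness transfer.\<close>

lemma stone_measure_spec:
  assumes C: "content_space C"
  defines "T \<equiv> stone_space (cont_top C) (cont_alg C)"
  shows "normal_borel_prob T (stone_measure C)"
    and "B \<in> cont_alg C \<Longrightarrow> measure (stone_measure C) (stone_clopen (cont_top C) (cont_alg C) B) = cont_msr C B"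
proof -
  let ?X = "cont_top C" and ?B = "cont_alg C" and ?\<mu> = "cont_msr C"
  interpret regular_algebra ?X ?B
    using C by unfold_locales (simp add: content_space_def)
  have \<mu>: "content_on ?X ?B ?\<mu>" "?\<mu> (topspace ?X) = 1" using C by (auto simp: content_space_def)
  let ?m = "\<lambda>U. ennreal (?\<mu> (inv_into ?B (stone_clopen ?X ?B) U))"
  interpret clopen_content T "stone_clopen ?X ?B ` ?B" ?m
    unfolding T_def by (rule clopen_content_stone[OF \<mu>])
  let ?P = "\<lambda>M. normal_borel_prob T M \<and> (\<forall>B\<in>?B. measure M (stone_clopen ?X ?B B) = ?\<mu> B)"
  have nonneg: "0 \<le> ?\<mu> B" if "B \<in> ?B" for B using \<mu>(1) that by (simp add: content_on_def)
  have eq: "?P M \<longleftrightarrow> normal_borel_prob T M \<and> (\<forall>A\<in>stone_clopen ?X ?B ` ?B. emeasure M A = ?m A)" for M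
  proof (cases "normal_borel_prob T M")
    case True
    then interpret prob_space M by (simp add: normal_borel_prob_def)
    show ?thesis using True nonneg
      by (auto simp: emeasure_eq_measure inj_on_stone_clopen)
  qed simp
  have "\<exists>!M. ?P M"
    unfolding eq by (intro ex_ex1I regular_extension_exists) (rule regular_extension_unique; simp)
  from theI'[OF this] have "?P (stone_measure C)" by (simp add: stone_measure_def T_def)
  then show "normal_borel_prob T (stone_measure C)"
    and "B \<in> cont_alg C \<Longrightarrow> measure (stone_measure C) (stone_clopen (cont_top C) (cont_alg C) B) = cont_msr C B"
    by auto
qed

section \<open>The Gleason map\<close>

locale content_sp =
  fixes C :: "'a content_triple"
  assumes content_space: "content_space C"
begin

abbreviation "X \<equiv> cont_top C"
abbreviation "\<BB> \<equiv> cont_alg C"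
abbreviation "Y \<equiv> stone_cech X"
abbreviation "S \<equiv> stone_space X \<BB>"
abbreviation "M \<equiv> stone_measure C"

sublocale regular_algebra X \<BB>
  using content_space by unfold_locales (simp add: content_space_def)

lemma completely_regular: "completely_regular_space X"
  using content_space
  by (simp add: content_space_def locally_compact_regular_imp_completely_regular_space)

lemma openin_hat: "B \<in> \<BB> \<Longrightarrow> openin Y (sc_hat X B)"
  using regular_open_in_sc_hat[OF completely_regular regular, of B] by (simp add: regular_open_in_def)

lemma sc_trace_hat: "B \<in> \<BB> \<Longrightarrow> sc_trace X (sc_hat X B) = B"
  by (simp add: sc_trace_sc_hat completely_regular)

lemma hat_base:
  assumes "openin Y U" "y \<in> U"
  obtains B where "B \<in> \<BB>" "y \<in> sc_hat X B" "sc_hat X B \<subseteq> U"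
proof -
  have "(arbitrary union_of (\<lambda>U. U \<in> sc_hat X ` \<BB>)) U"
    using content_space assms(1) by (simp add: content_space_def generative_def)
  then obtain \<U> where "\<U> \<subseteq> sc_hat X ` \<BB>" "\<Union>\<U> = U" by (auto simp: union_of_def)
  then show ?thesis using assms(2) that by blast
qed

lemma closure_of_hat_neg_disjoint:
  assumes "B \<in> \<BB>"
  shows "sc_hat X B \<inter> Y closure_of (sc_hat X (regular_neg X B)) = {}"
proof -
  have "sc_hat X B \<inter> sc_hat X (regular_neg X B) = {}"
    using assms by (simp add: sc_hat_regular_neg completely_regular regular_neg_disjoint)
  then show ?thesis using openin_Int_closure_of_eq_empty[OF openin_hat[OF assms]] by blast
qed

text \<open>Otherwise \<open>s\<close> contains the complement of \<open>B\<close>, and the closure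
  of its hat misses the hat of \<open>B\<close>. Uniqueness of the limit and continuity of the
  Gleason map both rest on this.\<close>

lemma mem_if_limit_in_hat:
  assumes s: "ultrafilter_of X \<BB> s" and B: "B \<in> \<BB>"
    and y: "\<And>A. A \<in> s \<Longrightarrow> y \<in> Y closure_of (sc_hat X A)" "y \<in> sc_hat X B"
  shows "B \<in> s"
proof (rule ccontr)
  assume "B \<notin> s"
  then have "regular_neg X B \<in> s" by (rule ultrafilter_ofD(6)[OF s B])
  then show False using y closure_of_hat_neg_disjoint[OF B] by blast
qed

text \<open>Separate two limits by disjoint open sets and shrink the first to the hat of some
  \<open>B\<close>. Then \<open>B\<close> belongs to \<open>s\<close>, so the second limit lies in
  the closure of the first open set, a contradiction.\<close>

lemma limit_unique:
  assumes s: "ultrafilter_of X \<BB> s"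
    and y: "\<And>A. A \<in> s \<Longrightarrow> y \<in> Y closure_of (sc_hat X A)"
    and z: "\<And>A. A \<in> s \<Longrightarrow> z \<in> Y closure_of (sc_hat X A)"
  shows "y = z"
proof (rule ccontr)
  assume "y \<noteq> z"
  moreover have "y \<in> topspace Y" "z \<in> topspace Y"
    using y[OF ultrafilter_ofD(2)[OF s]] z[OF ultrafilter_ofD(2)[OF s]]
    by (simp_all add: in_closure_of)
  ultimately obtain U V where UV: "openin Y U" "openin Y V" "y \<in> U" "z \<in> V" "disjnt U V"
    using Hausdorff_space_stone_cech[of X] unfolding Hausdorff_space_def by metis
  obtain B where B: "B \<in> \<BB>" "y \<in> sc_hat X B" "sc_hat X B \<subseteq> U" using hat_base UV(1,3) by blast
  have "B \<in> s" using mem_if_limit_in_hat[OF s B(1) y B(2)] .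
  then have "z \<in> Y closure_of U" using z closure_of_mono[OF B(3)] by blast
  then show False using UV by (auto simp: in_closure_of disjnt_iff)
qed

text \<open>Finitely many members of \<open>s\<close> have a common point of \<open>X\<close>, whose
  image lies in all the corresponding closures; compactness does the rest.\<close>

lemma limit_exists:
  assumes s: "ultrafilter_of X \<BB> s"
  shows "\<exists>y. \<forall>A\<in>s. y \<in> Y closure_of (sc_hat X A)"
proof -
  let ?F = "(\<lambda>A. Y closure_of (sc_hat X A)) ` s"
  have "\<Inter>G \<noteq> {}" if G: "finite G" "G \<subseteq> ?F" for G
  proof -
    obtain H where H: "finite H" "H \<subseteq> s" "G = (\<lambda>A. Y closure_of (sc_hat X A)) ` H"
      using finite_subset_image[OF G] by blast
    have "topspace X \<inter> \<Inter>H \<noteq> {}"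
      using ultrafilter_of_Inter[OF s H(1,2)] ultrafilter_ofD(3)[OF s] by metis
    then obtain x where x: "x \<in> topspace X" "\<And>A. A \<in> H \<Longrightarrow> x \<in> A" by blast
    have "sc_embed X x \<in> Y closure_of (sc_hat X A)" if A: "A \<in> H" for A
    proof -
      have AB: "A \<in> \<BB>" using A H ultrafilter_ofD(1)[OF s] by blast
      then have "sc_embed X x \<in> sc_hat X A" using sc_trace_hat x(2)[OF A] by (auto simp: sc_trace_def)
      then show ?thesis using closure_of_subset[OF openin_subset[OF openin_hat[OF AB]]] by blast
    qed
    then show ?thesis using H(3) by blast
  qed
  then have "\<Inter>?F \<noteq> {}"
    using compact_space_stone_cech[of X] unfolding compact_space_fip by simp
  then show ?thesis by blast
qed

lemma gleason_eqI:
  assumes s: "ultrafilter_of X \<BB> s" and y: "\<And>A. A \<in> s \<Longrightarrow> y \<in> Y closure_of (sc_hat X A)"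
  shows "gleason C s = y"
proof -
  have "(\<Inter>A\<in>s. Y closure_of (sc_hat X A)) = {y}"
    using limit_unique[OF s] y by blast
  then show ?thesis by (simp add: gleason_def)
qed

lemma gleason_mem:
  assumes s: "ultrafilter_of X \<BB> s" and A: "A \<in> s"
  shows "gleason C s \<in> Y closure_of (sc_hat X A)"
proof -
  obtain y where y: "\<And>A. A \<in> s \<Longrightarrow> y \<in> Y closure_of (sc_hat X A)" using limit_exists[OF s] by blast
  then show ?thesis using gleason_eqI[OF s y] A by simp
qed

lemma gleason_topspace: "ultrafilter_of X \<BB> s \<Longrightarrow> gleason C s \<in> topspace Y"
  using gleason_mem[OF _ ultrafilter_ofD(2)] by (auto simp: in_closure_of)

lemma continuous_map_gleason: "continuous_map S Y (gleason C)"
  unfolding continuous_map_def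
proof (intro conjI allI impI)
  show "gleason C \<in> topspace S \<rightarrow> topspace Y" by (auto simp: topspace_stone gleason_topspace)
  fix U assume U: "openin Y U"
  show "openin S {s \<in> topspace S. gleason C s \<in> U}"
  proof (subst openin_subopen, clarify)
    fix s assume "s \<in> topspace S" and sU: "gleason C s \<in> U"
    then have s: "ultrafilter_of X \<BB> s" by (simp add: topspace_stone)
    \<comment> \<open>Regularity leaves room for a closed set between the hat of \<open>B\<close>
      and \<open>U\<close>. Every ultrafilter containing \<open>B\<close> is sent into the closure
      of that hat, hence into \<open>U\<close>.\<close>
    have "regular_space Y"
      by (simp add: compact_Hausdorff_imp_regular_space compact_space_stone_cech Hausdorff_space_stone_cech)
    then obtain V K where V: "openin Y V" "closedin Y K" "gleason C s \<in> V" "V \<subseteq> K" "K \<subseteq> U"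
      using U sU unfolding neighbourhood_base_of_closedin[symmetric] neighbourhood_base_of by metis
    obtain B where B: "B \<in> \<BB>" "gleason C s \<in> sc_hat X B" "sc_hat X B \<subseteq> V" using hat_base V(1,3) by blast
    have "B \<in> s" using mem_if_limit_in_hat[OF s B(1) gleason_mem[OF s] B(2)] .
    moreover have "Y closure_of (sc_hat X B) \<subseteq> U"
      using closure_of_minimal[of "sc_hat X B" K Y] B V by blast
    ultimately have "s \<in> stone_clopen X \<BB> B"
      "stone_clopen X \<BB> B \<subseteq> {s \<in> topspace S. gleason C s \<in> U}"
      using s gleason_mem by (auto simp: stone_clopen_def topspace_stone)
    then show "\<exists>T. openin S T \<and> s \<in> T \<and> T \<subseteq> {s \<in> topspace S. gleason C s \<in> U}"
      using openin_stone_clopen[OF B(1)] by blast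
  qed
qed

section \<open>Integration on the Stone space\<close>

lemma normal: "normal_borel_prob S M"
  and measure_clopen: "B \<in> \<BB> \<Longrightarrow> measure M (stone_clopen X \<BB> B) = cont_msr C B"
  using stone_measure_spec[OF content_space] by auto

sublocale prob_space M
  using normal by (simp add: normal_borel_prob_def)

lemma sets_stone_measure: "sets M = sigma_sets (topspace S) {U. openin S U}"
  using normal by (simp add: normal_borel_prob_def)

lemma space_stone_measure: "space M = topspace S"
proof
  have "topspace S \<in> sets M" unfolding sets_stone_measure by auto
  then show "topspace S \<subseteq> space M" by (rule sets.sets_into_space)
  have "space M \<in> sigma_sets (topspace S) {U. openin S U}" unfolding sets_stone_measure[symmetric] by auto
  then show "space M \<subseteq> topspace S"
    by (rule sigma_sets_into_sp[rotated]) (auto dest: openin_subset)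
qed

text \<open>Compactness bounds \<open>g\<close>, and a bounded measurable function is integrable for
  a probability measure.\<close>

lemma integrable_continuous:
  assumes g: "continuous_map S euclideanreal g"
  shows "integrable M g"
proof -
  have "compactin euclideanreal (g ` topspace S)"
    using image_compactin[OF _ g] compact_space_stone by (simp add: compact_space_def)
  then have "bounded (g ` topspace S)" by (simp add: compact_imp_bounded)
  then obtain b where b: "\<And>s. s \<in> topspace S \<Longrightarrow> \<bar>g s\<bar> \<le> b" by (auto simp: bounded_iff)
  have "g \<in> borel_measurable M"
  proof (rule borel_measurableI)
    fix U :: "real set" assume "open U"
    then have "openin S {s \<in> topspace S. g s \<in> U}"
      using g by (intro openin_continuous_map_preimage) auto
    moreover have "g -` U \<inter> space M = {s \<in> topspace S. g s \<in> U}" by (auto simp: space_stone_measure)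
    ultimately show "g -` U \<inter> space M \<in> sets M" by (auto simp: sets_stone_measure)
  qed
  then show ?thesis
    using b by (intro integrable_const_bound[of _ b]) (auto simp: space_stone_measure)
qed

end

lemma closure_of_le:
  fixes g :: "'a \<Rightarrow> real"
  assumes "continuous_map Y euclideanreal g" "z \<in> Y closure_of Q" "\<And>w. w \<in> Q \<Longrightarrow> g w \<le> c"
  shows "g z \<le> c"
proof (rule forall_in_closure_of[OF assms(2)])
  have "closedin Y {x \<in> topspace Y. g x \<in> {..c}}"
    by (rule closedin_continuous_map_preimage[OF assms(1)]) simp
  then show "closedin Y {x \<in> topspace Y. g x \<le> c}" by simp
qed (rule assms(3))

lemma closure_of_ge:
  fixes g :: "'a \<Rightarrow> real"
  assumes "continuous_map Y euclideanreal g" "z \<in> Y closure_of Q" "\<And>w. w \<in> Q \<Longrightarrow> c \<le> g w"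
  shows "c \<le> g z"
proof (rule forall_in_closure_of[OF assms(2)])
  have "closedin Y {x \<in> topspace Y. g x \<in> {c..}}"
    by (rule closedin_continuous_map_preimage[OF assms(1)]) simp
  then show "closedin Y {x \<in> topspace Y. c \<le> g x}" by simp
qed (rule assms(3))

section \<open>The content integral as an integral over the Stone space\<close>

text \<open>A common criterion for both functors, with \<open>p\<close> the identity for
  \<open>Xi_obj\<close> and the Gleason map for \<open>Upsilon_obj\<close>. Linearity and
  monotonicity are inherited from the integral; the norm 1 is attained at the constant function
  1.\<close>

lemma integration_space_of_prob:
  fixes p :: "'b \<Rightarrow> 'a" and M :: "'b measure"
  assumes "locally_compact_space X" "Hausdorff_space X" "prob_space M"
    and p: "\<And>s. s \<in> space M \<Longrightarrow> p s \<in> topspace X"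
    and cont: "\<And>g. g \<in> G \<Longrightarrow> continuous_map X euclideanreal g"
    and cong: "\<And>g h. g \<in> G \<Longrightarrow> (\<And>x. x \<in> topspace X \<Longrightarrow> h x = g x) \<Longrightarrow> h \<in> G"
    and one: "(\<lambda>x. 1) \<in> G"
    and plus: "\<And>f g. f \<in> G \<Longrightarrow> g \<in> G \<Longrightarrow> (\<lambda>x. f x + g x) \<in> G"
    and scale: "\<And>c g. g \<in> G \<Longrightarrow> (\<lambda>x. c * g x) \<in> G"
    and int: "\<And>g. g \<in> G \<Longrightarrow> integrable M (\<lambda>s. g (p s))"
    and J: "\<And>g. g \<in> G \<Longrightarrow> J g = (\<integral>s. g (p s) \<partial>M)"
  shows "integration_space \<lparr>itg_top = X, itg_fns = G, itg_fun = J\<rparr>"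
proof -
  interpret prob_space M by fact
  let ?V = "{\<bar>J g\<bar> | g. g \<in> G \<and> (\<forall>x\<in>topspace X. \<bar>g x\<bar> \<le> 1)}"
  have mono: "J f \<le> J g" if "f \<in> G" "g \<in> G" "\<forall>x\<in>topspace X. f x \<le> g x" for f g
    using that p by (simp add: J int integral_mono)
  have J1: "J (\<lambda>x. 1) = 1" using J[OF one] by (simp add: prob_space)
  have Jc: "J (\<lambda>x. c * g x) = c * J g" if "g \<in> G" for c g
    using that by (simp add: J scale)
  have Jp: "J (\<lambda>x. f x + g x) = J f + J g" if "f \<in> G" "g \<in> G" for f g
    using that by (simp add: J plus int)
  have le: "\<bar>J g\<bar> \<le> 1" if g: "g \<in> G" "\<forall>x\<in>topspace X. \<bar>g x\<bar> \<le> 1" for g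
  proof -
    have "J g \<le> J (\<lambda>x. 1)" using g one by (intro mono) (auto simp: abs_le_iff)
    moreover have "J (\<lambda>x. - 1 * g x) \<le> J (\<lambda>x. 1)"
      using g one scale[OF g(1), of "- 1"] by (intro mono) (auto simp: abs_le_iff)
    ultimately show ?thesis using Jc[OF g(1), of "- 1"] by (simp add: J1 abs_le_iff)
  qed
  have ub: "v \<le> 1" if "v \<in> ?V" for v using that le by auto
  have "bdd_above ?V" using ub by (rule bdd_aboveI)
  moreover have "1 \<in> ?V"
    unfolding mem_Collect_eq using J1 one by (intro exI[of _ "\<lambda>x. 1"]) simp
  then have "Sup ?V = 1" by (rule cSup_eq_maximum) (rule ub)
  moreover have "(\<lambda>x. 0) \<in> G" using scale[OF one, of 0] by simp
  ultimately show ?thesis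
    unfolding integration_space_def Let_def
    using assms(1,2) cont cong plus scale Jc Jp mono by simp
qed

section \<open>Linear structure of the closed span of comeasurable functions\<close>

lemma comeasurable_span_add_mult:
  assumes "h \<in> comeasurable_span Y \<AA>" "comeasurable Y \<AA> f"
  shows "(\<lambda>x. h x + c * f x) \<in> comeasurable_span Y \<AA>"
proof -
  obtain n d F where h: "h = (\<lambda>x. \<Sum>i<(n::nat). d i * F i x)" "\<forall>i<n. comeasurable Y \<AA> (F i)"
    using assms(1) unfolding comeasurable_span_def by auto
  show ?thesis
    unfolding comeasurable_span_def mem_Collect_eq
    using h(2) assms(2)
    by (intro exI[of _ "Suc n"] exI[of _ "d(n := c)"] exI[of _ "F(n := f)"]) (auto simp: h(1))
qed

lemma comeasurable_span_add:
  assumes h: "h \<in> comeasurable_span Y \<AA>" and k: "k \<in> comeasurable_span Y \<AA>"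
  shows "(\<lambda>x. h x + k x) \<in> comeasurable_span Y \<AA>"
proof -
  obtain n d F where k: "k = (\<lambda>x. \<Sum>i<(n::nat). d i * F i x)" "\<forall>i<n. comeasurable Y \<AA> (F i)"
    using k unfolding comeasurable_span_def by auto
  have "(\<lambda>x. h x + (\<Sum>i<n. d i * F i x)) \<in> comeasurable_span Y \<AA>"
    using k(2)
  proof (induction n)
    case (Suc n)
    then have "(\<lambda>x. (h x + (\<Sum>i<n. d i * F i x)) + d n * F n x) \<in> comeasurable_span Y \<AA>"
      by (intro comeasurable_span_add_mult) auto
    then show ?case by (simp add: add.assoc)
  qed (simp add: h)
  then show ?thesis by (simp add: k(1))
qed

lemma comeasurable_span_mult:
  assumes k: "k \<in> comeasurable_span Y \<AA>"
  shows "(\<lambda>x. c * k x) \<in> comeasurable_span Y \<AA>"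
proof -
  obtain n d F where k: "k = (\<lambda>x. \<Sum>i<(n::nat). d i * F i x)" "\<forall>i<n. comeasurable Y \<AA> (F i)"
    using k unfolding comeasurable_span_def by auto
  show ?thesis
    unfolding comeasurable_span_def mem_Collect_eq
    by (intro exI[of _ n] exI[of _ "\<lambda>i. c * d i"] exI[of _ F])
      (simp add: k sum_distrib_left mult.assoc)
qed

lemma comeasurable_subset_closed_span:
  assumes "comeasurable Y \<AA> f"
  shows "f \<in> comeasurable_closed_span Y \<AA>"
proof -
  have "(\<lambda>x. 0) \<in> comeasurable_span Y \<AA>" unfolding comeasurable_span_def by (auto intro!: exI[of _ 0])
  from comeasurable_span_add_mult[OF this assms, of 1] have "f \<in> comeasurable_span Y \<AA>" by simp
  then show ?thesis
    using assms unfolding comeasurable_closed_span_def comeasurable_def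
    by (auto intro!: bexI[of _ f])
qed

lemma comeasurable_closed_spanD:
  assumes "g \<in> comeasurable_closed_span Y \<AA>"
  shows "continuous_map Y euclideanreal g" "bounded (g ` topspace Y)"
    "0 < \<epsilon> \<Longrightarrow> \<exists>h\<in>comeasurable_span Y \<AA>. \<forall>x\<in>topspace Y. \<bar>g x - h x\<bar> \<le> \<epsilon>"
  using assms by (auto simp: comeasurable_closed_span_def)

lemma comeasurable_closed_span_add:
  assumes f: "f \<in> comeasurable_closed_span Y \<AA>" and g: "g \<in> comeasurable_closed_span Y \<AA>"
  shows "(\<lambda>x. f x + g x) \<in> comeasurable_closed_span Y \<AA>"
  unfolding comeasurable_closed_span_def
proof (intro CollectI conjI allI impI)
  show "continuous_map Y euclideanreal (\<lambda>x. f x + g x)"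
    by (intro continuous_map_add comeasurable_closed_spanD(1)[OF f] comeasurable_closed_spanD(1)[OF g])
  show "bounded ((\<lambda>x. f x + g x) ` topspace Y)"
    by (intro bounded_plus_comp comeasurable_closed_spanD(2)[OF f] comeasurable_closed_spanD(2)[OF g])
  fix e :: real assume e: "0 < e"
  obtain h where h: "h \<in> comeasurable_span Y \<AA>" "\<And>x. x \<in> topspace Y \<Longrightarrow> \<bar>f x - h x\<bar> \<le> e / 2"
    using comeasurable_closed_spanD(3)[OF f half_gt_zero[OF e]] by blast
  obtain k where k: "k \<in> comeasurable_span Y \<AA>" "\<And>x. x \<in> topspace Y \<Longrightarrow> \<bar>g x - k x\<bar> \<le> e / 2"
    using comeasurable_closed_spanD(3)[OF g half_gt_zero[OF e]] by blast
  have "\<bar>f x + g x - (h x + k x)\<bar> \<le> e" if "x \<in> topspace Y" for x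
    using h(2)[OF that] k(2)[OF that] by linarith
  then show "\<exists>h\<in>comeasurable_span Y \<AA>. \<forall>x\<in>topspace Y. \<bar>f x + g x - h x\<bar> \<le> e"
    using comeasurable_span_add[OF h(1) k(1)]
    by (intro bexI[of _ "\<lambda>x. h x + k x"] ballI) simp_all
qed

lemma comeasurable_closed_span_mult:
  assumes g: "g \<in> comeasurable_closed_span Y \<AA>"
  shows "(\<lambda>x. c * g x) \<in> comeasurable_closed_span Y \<AA>"
  unfolding comeasurable_closed_span_def
proof (intro CollectI conjI allI impI)
  show "continuous_map Y euclideanreal (\<lambda>x. c * g x)"
    by (intro continuous_map_real_mult_left comeasurable_closed_spanD(1)[OF g])
  show "bounded ((\<lambda>x. c * g x) ` topspace Y)"
    using bounded_scaling[OF comeasurable_closed_spanD(2)[OF g], of c] by (simp add: image_image)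
  fix e :: real assume e: "0 < e"
  \<comment> \<open>The summand 1 in the denominator covers \<open>c = 0\<close>.\<close>
  then have "0 < e / (\<bar>c\<bar> + 1)" by simp
  then obtain k where k: "k \<in> comeasurable_span Y \<AA>"
      "\<And>x. x \<in> topspace Y \<Longrightarrow> \<bar>g x - k x\<bar> \<le> e / (\<bar>c\<bar> + 1)"
    using comeasurable_closed_spanD(3)[OF g, of "e / (\<bar>c\<bar> + 1)"] by blast
  have "\<bar>c * g x - c * k x\<bar> \<le> e" if "x \<in> topspace Y" for x
  proof -
    have "\<bar>c * g x - c * k x\<bar> = \<bar>c\<bar> * \<bar>g x - k x\<bar>" by (simp add: abs_mult flip: right_diff_distrib)
    also have "\<dots> \<le> (\<bar>c\<bar> + 1) * (e / (\<bar>c\<bar> + 1))" using k(2)[OF that] by (intro mult_mono) auto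
    also have "\<dots> = e" by (simp add: add_pos_nonneg add_nonneg_pos less_imp_neq[symmetric])
    finally show ?thesis .
  qed
  then show "\<exists>h\<in>comeasurable_span Y \<AA>. \<forall>x\<in>topspace Y. \<bar>c * g x - h x\<bar> \<le> e"
    using comeasurable_span_mult[OF k(1), of c]
    by (intro bexI[of _ "\<lambda>x. c * k x"] ballI) simp_all
qed

lemma comeasurable_closed_span_cong:
  assumes g: "g \<in> comeasurable_closed_span Y \<AA>" and eq: "\<And>x. x \<in> topspace Y \<Longrightarrow> h x = g x"
  shows "h \<in> comeasurable_closed_span Y \<AA>"
proof -
  have "continuous_map Y euclideanreal h"
    by (rule continuous_map_eq[of Y euclideanreal g]) (use g eq in \<open>auto simp: comeasurable_closed_span_def\<close>)
  moreover have "h ` topspace Y = g ` topspace Y" using eq by auto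
  ultimately show ?thesis using g eq by (simp add: comeasurable_closed_span_def)
qed

section \<open>Simple functions and the content integral on the compactification\<close>

context content_sp
begin

abbreviation "\<BB>\<^sub>h \<equiv> sc_hat X ` \<BB>"
abbreviation "\<mu>\<^sub>h \<equiv> \<lambda>Q. cont_msr C (sc_trace X Q)"

lemma hat_alg_trace: "Q \<in> \<BB>\<^sub>h \<Longrightarrow> sc_trace X Q \<in> \<BB> \<and> sc_hat X (sc_trace X Q) = Q"
  by (auto simp: sc_trace_hat)

lemma openin_hat_alg: "Q \<in> \<BB>\<^sub>h \<Longrightarrow> openin Y Q"
  using openin_hat by auto

lemma hat_alg_Int: "P \<in> \<BB>\<^sub>h \<Longrightarrow> Q \<in> \<BB>\<^sub>h \<Longrightarrow> P \<inter> Q \<in> \<BB>\<^sub>h"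
  by (auto simp flip: sc_hat_Int[OF completely_regular])

lemma hat_alg_neg: "Q \<in> \<BB>\<^sub>h \<Longrightarrow> regular_neg Y Q \<in> \<BB>\<^sub>h"
  by (auto simp flip: sc_hat_regular_neg[OF completely_regular])

lemma hat_alg_topspace: "topspace Y \<in> \<BB>\<^sub>h"
  using sc_hat_topspace[OF completely_regular] topspace_mem by (metis image_eqI)

lemma hat_alg_empty: "{} \<in> \<BB>\<^sub>h"
  using sc_hat_empty[OF completely_regular] empty_mem by (metis image_eqI)

text \<open>The step function on the Stone space attached to a simple function. As a sum of
  indicators it has an evident integral; its pointwise values are recovered in
  \<open>simple_rep_cell\<close>.\<close>

definition cell_function :: "nat \<Rightarrow> (nat \<Rightarrow> (('a \<Rightarrow> real) \<Rightarrow> real) set) \<Rightarrow> (nat \<Rightarrow> real) \<Rightarrow> 'a set set \<Rightarrow> real" where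
  "cell_function N P r s = (\<Sum>n<N. r n * indicator (stone_clopen X \<BB> (sc_trace X (P n))) s)"

text \<open>An ultrafilter contains exactly one cell of a partition: at most one by disjointness,
  and at least one because the union of the cells is dense.\<close>

lemma simple_rep_cell:
  assumes rep: "simple_rep Y \<BB>\<^sub>h f N P r" and s: "ultrafilter_of X \<BB> s"
  obtains n where "n < N" "sc_trace X (P n) \<in> s" "cell_function N P r s = r n"
proof -
  have P: "P n \<in> \<BB>\<^sub>h" if "n < N" for n using rep that by (simp add: simple_rep_def)
  have dis: "P m \<inter> P n = {}" if "m < N" "n < N" "m \<noteq> n" for m n
    using rep that by (auto simp: simple_rep_def disjoint_family_on_def)
  have "\<exists>n<N. sc_trace X (P n) \<in> s"
  proof (rule ccontr)
    assume "\<not> (\<exists>n<N. sc_trace X (P n) \<in> s)"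
    then have neg: "regular_neg X (sc_trace X (P n)) \<in> s" if "n < N" for n
      using that hat_alg_trace[OF P] ultrafilter_ofD(6)[OF s] by blast
    \<comment> \<open>If no cell belongs to \<open>s\<close>, all their complements do. Their
      intersection is then a nonempty element whose hat is open and misses every cell.\<close>
    define D where "D = topspace X \<inter> \<Inter>((\<lambda>n. regular_neg X (sc_trace X (P n))) ` {..<N})"
    have "D \<in> s" unfolding D_def using neg by (intro ultrafilter_of_Inter[OF s]) auto
    then have D: "D \<in> \<BB>" "D \<noteq> {}" using ultrafilter_ofD(1,3)[OF s] by auto
    have hD: "openin Y (sc_hat X D)" "sc_hat X D \<noteq> {}"
      using openin_hat D sc_trace_hat[OF D(1)] by (auto simp: sc_trace_def)
    have "sc_hat X D \<inter> P n = {}" if "n < N" for n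
    proof -
      have "sc_trace X (sc_hat X D \<inter> P n) = D \<inter> sc_trace X (P n)"
        by (simp add: sc_trace_Int sc_trace_hat D)
      also have "\<dots> \<subseteq> sc_trace X (P n) \<inter> regular_neg X (sc_trace X (P n))"
        unfolding D_def using that by auto
      finally have "sc_trace X (sc_hat X D \<inter> P n) = {}" by (simp add: regular_neg_disjoint)
      then show ?thesis
        using sc_trace_eq_empty_iff[of X "sc_hat X D \<inter> P n"] hD(1) openin_hat_alg[OF P[OF that]] by auto
    qed
    then have "sc_hat X D \<inter> (\<Union>n<N. P n) = {}" by blast
    then have "sc_hat X D \<inter> Y closure_of (\<Union>n<N. P n) = {}"
      using openin_Int_closure_of_eq_empty[OF hD(1)] by blast
    moreover have "topspace Y \<subseteq> Y closure_of (\<Union>n<N. P n)"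
      using rep interior_of_subset unfolding simple_rep_def regular_Join_def by metis
    ultimately show False using hD openin_subset by blast
  qed
  then obtain n where n: "n < N" "sc_trace X (P n) \<in> s" by blast
  have "sc_trace X (P m) \<notin> s" if "m < N" "m \<noteq> n" for m
  proof
    assume "sc_trace X (P m) \<in> s"
    then have "sc_trace X (P m \<inter> P n) \<in> s" using n(2) ultrafilter_ofD(4)[OF s] by (simp add: sc_trace_Int)
    then show False using dis[OF that(1) n(1) that(2)] ultrafilter_ofD(3)[OF s] by (simp add: sc_trace_def)
  qed
  then have "cell_function N P r s = (\<Sum>m<N. if m = n then r n else 0)"
    unfolding cell_function_def using n s
    by (intro sum.cong) (auto simp: stone_clopen_def indicator_def)
  also have "\<dots> = r n" using n(1) by simp
  finally show ?thesis using n that by blast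
qed

lemma clopen_in_sets: "B \<in> \<BB> \<Longrightarrow> stone_clopen X \<BB> B \<in> sets M"
  using openin_stone_clopen by (auto simp: sets_stone_measure)

lemma integral_cell_function:
  assumes "simple_rep Y \<BB>\<^sub>h f N P r"
  shows "integrable M (cell_function N P r)"
    and "(\<integral>s. cell_function N P r s \<partial>M) = (\<Sum>n<N. r n * \<mu>\<^sub>h (P n))"
proof -
  have B: "sc_trace X (P n) \<in> \<BB>" if "n < N" for n
    using assms that hat_alg_trace by (auto simp: simple_rep_def)
  have i: "integrable M (\<lambda>s. r n * indicator (stone_clopen X \<BB> (sc_trace X (P n))) s)" if "n < N" for n
    using clopen_in_sets[OF B[OF that]] by (simp add: emeasure_eq_measure)
  then show "integrable M (cell_function N P r)"
    unfolding cell_function_def by (intro Bochner_Integration.integrable_sum) auto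
  have "(\<integral>s. cell_function N P r s \<partial>M)
      = (\<Sum>n<N. \<integral>s. r n * indicator (stone_clopen X \<BB> (sc_trace X (P n))) s \<partial>M)"
    unfolding cell_function_def using i by (intro Bochner_Integration.integral_sum) auto
  also have "\<dots> = (\<Sum>n<N. r n * \<mu>\<^sub>h (P n))"
    using clopen_in_sets[OF B] measure_clopen[OF B] sets.sets_into_space[OF clopen_in_sets[OF B]]
    by (intro sum.cong) (auto simp: Int_absorb2)
  finally show "(\<integral>s. cell_function N P r s \<partial>M) = (\<Sum>n<N. r n * \<mu>\<^sub>h (P n))" .
qed

text \<open>The two cells selected by \<open>s\<close> share a point of \<open>X\<close>, at which
  \<open>f\<close> takes both values. This makes the integral of a simple function independent of
  its representation.\<close>

lemma cell_function_unique:
  assumes "simple_rep Y \<BB>\<^sub>h f N P r" "simple_rep Y \<BB>\<^sub>h f N' P' r'" "ultrafilter_of X \<BB> s"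
  shows "cell_function N P r s = cell_function N' P' r' s"
proof -
  obtain n where n: "n < N" "sc_trace X (P n) \<in> s" "cell_function N P r s = r n"
    using simple_rep_cell assms(1,3) by blast
  obtain m where m: "m < N'" "sc_trace X (P' m) \<in> s" "cell_function N' P' r' s = r' m"
    using simple_rep_cell assms(2,3) by blast
  have "sc_trace X (P n) \<inter> sc_trace X (P' m) \<in> s" using n m ultrafilter_ofD(4)[OF assms(3)] by blast
  then have "sc_trace X (P n) \<inter> sc_trace X (P' m) \<noteq> {}" using ultrafilter_ofD(3)[OF assms(3)] by metis
  then obtain x where "sc_embed X x \<in> P n" "sc_embed X x \<in> P' m" by (auto simp: sc_trace_def)
  then have "r n = r' m" using assms(1,2) n(1) m(1) unfolding simple_rep_def by metis
  then show ?thesis using n m by simp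
qed

lemma simple_content_integral_eq:
  assumes rep: "simple_rep Y \<BB>\<^sub>h f N P r"
  shows "simple_content_integral Y \<BB>\<^sub>h \<mu>\<^sub>h f = (\<integral>s. cell_function N P r s \<partial>M)"
  unfolding simple_content_integral_def
proof (rule the_equality)
  show "\<exists>N' P' r'. simple_rep Y \<BB>\<^sub>h f N' P' r' \<and>
      (\<integral>s. cell_function N P r s \<partial>M) = (\<Sum>n<N'. r' n * \<mu>\<^sub>h (P' n))"
    using rep integral_cell_function(2) by blast
  fix v assume "\<exists>N' P' r'. simple_rep Y \<BB>\<^sub>h f N' P' r' \<and> v = (\<Sum>n<N'. r' n * \<mu>\<^sub>h (P' n))"
  then obtain N' P' r' where rep': "simple_rep Y \<BB>\<^sub>h f N' P' r'" "v = (\<integral>s. cell_function N' P' r' s \<partial>M)"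
    using integral_cell_function(2) by metis
  then show "v = (\<integral>s. cell_function N P r s \<partial>M)"
    using cell_function_unique[OF rep'(1) rep]
    by (auto intro!: Bochner_Integration.integral_cong simp: space_stone_measure topspace_stone)
qed

lemma integrable_comp_gleason:
  "continuous_map Y euclideanreal g \<Longrightarrow> integrable M (\<lambda>s. g (gleason C s))"
  using integrable_continuous continuous_map_compose[OF continuous_map_gleason] by (auto simp: comp_def)

text \<open>The Gleason image of \<open>s\<close> lies in the closure of the cell selected by
  \<open>s\<close>, and bounds for the continuous \<open>g\<close> on a cell persist on its
  closure.\<close>

lemma cell_function_le:
  assumes g: "continuous_map Y euclideanreal g" and rep: "simple_rep Y \<BB>\<^sub>h f N P r"
    and s: "ultrafilter_of X \<BB> s"
  shows "(\<And>n z. n < N \<Longrightarrow> z \<in> P n \<Longrightarrow> r n \<le> g z) \<Longrightarrow> cell_function N P r s \<le> g (gleason C s)"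
    and "(\<And>n z. n < N \<Longrightarrow> z \<in> P n \<Longrightarrow> g z \<le> r n + c) \<Longrightarrow> g (gleason C s) \<le> cell_function N P r s + c"
proof -
  obtain n where n: "n < N" "sc_trace X (P n) \<in> s" "cell_function N P r s = r n"
    using simple_rep_cell[OF rep s] by blast
  have "sc_hat X (sc_trace X (P n)) = P n" using rep n(1) hat_alg_trace by (simp add: simple_rep_def)
  then have cl: "gleason C s \<in> Y closure_of P n" using gleason_mem[OF s n(2)] by simp
  show "cell_function N P r s \<le> g (gleason C s)" if "\<And>n z. n < N \<Longrightarrow> z \<in> P n \<Longrightarrow> r n \<le> g z"
    unfolding n(3) using that n(1) by (intro closure_of_ge[OF g cl]) auto
  show "g (gleason C s) \<le> cell_function N P r s + c" if "\<And>n z. n < N \<Longrightarrow> z \<in> P n \<Longrightarrow> g z \<le> r n + c"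
    unfolding n(3) using that n(1) by (intro closure_of_le[OF g cl]) auto
qed

text \<open>Compactness gives a finite cover by hats on which \<open>g\<close> is nearly constant.
  Making it disjoint inside the algebra may lose boundary points, but the union stays dense, so the
  join is still the whole space.\<close>

lemma fine_partition_exists:
  assumes g: "continuous_map Y euclideanreal g" and e: "0 < e"
  obtains N P c where "\<And>n. n < N \<Longrightarrow> P n \<in> \<BB>\<^sub>h" "disjoint_family_on P {..<N}"
    "regular_Join Y N P = topspace Y" "\<And>n z. n < N \<Longrightarrow> z \<in> P n \<Longrightarrow> \<bar>g z - c n\<bar> \<le> e"
proof -
  let ?\<U> = "{Q\<in>\<BB>\<^sub>h. \<exists>c. \<forall>z\<in>Q. \<bar>g z - c\<bar> \<le> e}"
  have "topspace Y \<subseteq> \<Union>?\<U>"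
  proof
    fix y assume y: "y \<in> topspace Y"
    have "openin Y {z \<in> topspace Y. g z \<in> ball (g y) e}"
      by (rule openin_continuous_map_preimage[OF g]) simp
    moreover have "y \<in> {z \<in> topspace Y. g z \<in> ball (g y) e}" using y e by simp
    ultimately obtain B where B: "B \<in> \<BB>" "y \<in> sc_hat X B"
        "sc_hat X B \<subseteq> {z \<in> topspace Y. g z \<in> ball (g y) e}" by (rule hat_base)
    have "\<forall>z\<in>sc_hat X B. \<bar>g z - g y\<bar> \<le> e" using B(3) by (auto simp: dist_real_def)
    then show "y \<in> \<Union>?\<U>" using B by blast
  qed
  moreover have "openin Y U" if "U \<in> ?\<U>" for U using that openin_hat_alg by blast
  moreover have "compactin Y (topspace Y)"
    using compact_space_stone_cech[of X] by (simp add: compact_space_def)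
  ultimately have "\<exists>\<F>. finite \<F> \<and> \<F> \<subseteq> ?\<U> \<and> topspace Y \<subseteq> \<Union>\<F>" by (intro compactinD)
  then obtain \<F> where \<F>: "finite \<F>" "\<F> \<subseteq> ?\<U>" "topspace Y \<subseteq> \<Union>\<F>" by blast
  obtain Q where Q: "bij_betw Q {0..<card \<F>} \<F>" using ex_bij_betw_nat_finite[OF \<F>(1)] by blast
  define N where "N = card \<F>"
  have Qim: "Q ` {..<N} = \<F>" using Q by (simp add: bij_betw_def N_def atLeast0LessThan)
  have Qn: "Q n \<in> \<BB>\<^sub>h" "\<exists>c. \<forall>z\<in>Q n. \<bar>g z - c\<bar> \<le> e" if "n < N" for n
    using Qim \<F>(2) that by auto
  then obtain c where c: "\<And>n z. n < N \<Longrightarrow> z \<in> Q n \<Longrightarrow> \<bar>g z - c n\<bar> \<le> e" by metis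
  \<comment> \<open>Intersection with the regular complements of all earlier sets; for
    \<open>n = 0\<close> it is the whole space.\<close>
  define R where "R n = topspace Y \<inter> (\<Inter>j<n. regular_neg Y (Q j))" for n :: nat
  define P where "P n = Q n \<inter> R n" for n
  have R: "R n \<in> \<BB>\<^sub>h" if "n \<le> N" for n
    using that
  proof (induction n)
    case 0
    then show ?case by (simp add: R_def hat_alg_topspace)
  next
    case (Suc n)
    have "R (Suc n) = R n \<inter> regular_neg Y (Q n)" by (auto simp: R_def lessThan_Suc)
    then show ?case using Suc Qn(1)[of n] hat_alg_Int hat_alg_neg by simp
  qed
  have P: "P n \<in> \<BB>\<^sub>h" if "n < N" for n
    unfolding P_def using hat_alg_Int Qn(1)[OF that] R[of n] that by simp
  have "P m \<inter> P n = {}" if "m < n" for m n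
  proof -
    have "P m \<inter> P n \<subseteq> Q m \<inter> regular_neg Y (Q m)" using that by (auto simp: P_def R_def)
    then show ?thesis by (simp add: regular_neg_disjoint)
  qed
  then have dis: "disjoint_family_on P {..<N}"
    unfolding disjoint_family_on_def by (metis Int_commute linorder_neqE_nat)
  have "y \<in> Y closure_of (\<Union>n<N. P n)" if y: "y \<in> topspace Y" for y
    unfolding in_closure_of
  proof (intro conjI allI impI y)
    fix W assume W: "y \<in> W \<and> openin Y W"
    have "y \<in> \<Union>(Q ` {..<N})" using \<F>(3) y unfolding Qim by blast
    then have ex: "\<exists>n. n < N \<and> W \<inter> Q n \<noteq> {}" using W by auto
    \<comment> \<open>For the first \<open>Q n\<close> that meets \<open>W\<close>, the open set
      \<open>W \<inter> Q n\<close> misses all earlier sets, so it lies in their complements and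
      hence in \<open>P n\<close>.\<close>
    define n where "n = (LEAST n. n < N \<and> W \<inter> Q n \<noteq> {})"
    have n: "n < N" "W \<inter> Q n \<noteq> {}" using LeastI_ex[OF ex] by (auto simp: n_def)
    have low: "W \<inter> Q j = {}" if "j < n" for j
      using not_less_Least[of j "\<lambda>n. n < N \<and> W \<inter> Q n \<noteq> {}"] that n(1) by (auto simp: n_def)
    have oW: "openin Y (W \<inter> Q n)" using W openin_hat_alg[OF Qn(1)[OF n(1)]] by blast
    have "W \<inter> Q n \<subseteq> regular_neg Y (Q j)" if "j < n" for j
      using low[OF that] by (intro subset_regular_neg[OF oW]) blast
    then have "W \<inter> Q n \<subseteq> P n" using openin_subset[OF oW] by (auto simp: P_def R_def)
    then show "\<exists>z. z \<in> (\<Union>n<N. P n) \<and> z \<in> W" using n by blast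
  qed
  then have "Y closure_of (\<Union>n<N. P n) = topspace Y" by (auto simp: in_closure_of)
  then have "regular_Join Y N P = topspace Y" by (simp add: regular_Join_def)
  then show ?thesis using that[of N P c] P dis c by (auto simp: P_def)
qed

lemma simple_approximation:
  assumes g: "continuous_map Y euclideanreal g" and e: "0 < e"
  obtains f N P r where "simple_rep Y \<BB>\<^sub>h f N P r" "bounded (f ` topspace Y)"
    "\<And>x. x \<in> topspace Y \<Longrightarrow> f x \<le> g x" "\<And>n z. n < N \<Longrightarrow> z \<in> P n \<Longrightarrow> g z \<le> r n + e"
proof -
  have "0 < e / 2" using e by simp
  then obtain N P c where P: "\<And>n. n < N \<Longrightarrow> P n \<in> \<BB>\<^sub>h" "disjoint_family_on P {..<N}"
    "regular_Join Y N P = topspace Y" "\<And>n z. n < N \<Longrightarrow> z \<in> P n \<Longrightarrow> \<bar>g z - c n\<bar> \<le> e / 2"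
    using fine_partition_exists[OF g] by metis
  have "compactin euclideanreal (g ` topspace Y)"
    using image_compactin[OF _ g] compact_space_stone_cech[of X] by (simp add: compact_space_def)
  then have "bounded (g ` topspace Y)" by (simp add: compact_imp_bounded)
  then obtain b where b: "\<And>z. z \<in> topspace Y \<Longrightarrow> \<bar>g z\<bar> \<le> b" by (auto simp: bounded_iff)
  define i where "i x = (THE n. n < N \<and> x \<in> P n)" for x
  have i: "i x = n" if "n < N" "x \<in> P n" for n x
    unfolding i_def
  proof (rule the_equality)
    fix m assume "m < N \<and> x \<in> P m"
    then show "m = n" using P(2) that unfolding disjoint_family_on_def by blast
  qed (use that in simp)
  \<comment> \<open>Lowering the centre \<open>c n\<close> by \<open>e / 2\<close> puts
    \<open>f\<close> below \<open>g\<close> on the cell, with a gap of at most \<open>e\<close>. Off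
    the cells \<open>f\<close> must also stay below \<open>g\<close>, which the lower bound
    \<open>- b\<close> ensures.\<close>
  define f where "f x = (if \<exists>n<N. x \<in> P n then c (i x) - e / 2 else - b)" for x
  have "simple_rep Y \<BB>\<^sub>h f N P (\<lambda>n. c n - e / 2)"
    unfolding simple_rep_def using P(1-3) i by (auto simp: f_def)
  moreover have "bounded (f ` topspace Y)"
  proof (rule finite_imp_bounded[OF finite_subset])
    show "f ` topspace Y \<subseteq> insert (- b) ((\<lambda>n. c n - e / 2) ` {..<N})"
      using i by (auto simp: f_def)
  qed simp
  moreover have "f x \<le> g x" if x: "x \<in> topspace Y" for x
  proof (cases "\<exists>n<N. x \<in> P n")
    case True
    then obtain n where n: "n < N" "x \<in> P n" by blast
    then have "f x = c n - e / 2" using i by (auto simp: f_def)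
    then show ?thesis using P(4)[OF n] by linarith
  next
    case False
    then show ?thesis using b[OF x] by (auto simp: f_def)
  qed
  moreover have "g z \<le> (c n - e / 2) + e" if "n < N" "z \<in> P n" for n z
    using P(4)[OF that] by linarith
  ultimately show ?thesis using that by blast
qed

text \<open>The integral over the Stone space is shown to be the least upper bound: comparison of
  step functions with \<open>g \<circ> gleason C\<close> bounds every simple integral, and fine
  partitions come within any \<open>e\<close> of it.\<close>

lemma content_integral_eq:
  assumes g: "continuous_map Y euclideanreal g"
  shows "content_integral Y \<BB>\<^sub>h \<mu>\<^sub>h g = (\<integral>s. g (gleason C s) \<partial>M)"
  unfolding content_integral_def
proof (rule cSup_eq)
  note int = integrable_comp_gleason[OF g]
  fix v assume "v \<in> {simple_content_integral Y \<BB>\<^sub>h \<mu>\<^sub>h f | f.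
      bounded_simple Y \<BB>\<^sub>h f \<and> (\<forall>x\<in>topspace Y. f x \<le> g x)}"
  then obtain f N P r where f: "v = simple_content_integral Y \<BB>\<^sub>h \<mu>\<^sub>h f"
      "simple_rep Y \<BB>\<^sub>h f N P r" "\<forall>x\<in>topspace Y. f x \<le> g x"
    unfolding bounded_simple_def by blast
  have "r n \<le> g z" if "n < N" "z \<in> P n" for n z
  proof -
    have "P n \<in> \<BB>\<^sub>h" "f z = r n" using f(2) that by (auto simp: simple_rep_def)
    then show ?thesis using f(3) openin_subset[OF openin_hat_alg] that(2) by fastforce
  qed
  then show "v \<le> (\<integral>s. g (gleason C s) \<partial>M)"
    unfolding f(1) simple_content_integral_eq[OF f(2)]
    using cell_function_le(1)[OF g f(2)] int integral_cell_function(1)[OF f(2)]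
    by (intro integral_mono) (auto simp: space_stone_measure topspace_stone)
next
  note int = integrable_comp_gleason[OF g]
  fix v assume ub: "\<And>w. w \<in> {simple_content_integral Y \<BB>\<^sub>h \<mu>\<^sub>h f | f.
      bounded_simple Y \<BB>\<^sub>h f \<and> (\<forall>x\<in>topspace Y. f x \<le> g x)} \<Longrightarrow> w \<le> v"
  show "(\<integral>s. g (gleason C s) \<partial>M) \<le> v"
  proof (rule field_le_epsilon)
    fix e :: real assume e: "0 < e"
    obtain f N P r where f: "simple_rep Y \<BB>\<^sub>h f N P r" "bounded (f ` topspace Y)"
      "\<And>x. x \<in> topspace Y \<Longrightarrow> f x \<le> g x" "\<And>n z. n < N \<Longrightarrow> z \<in> P n \<Longrightarrow> g z \<le> r n + e"
      using simple_approximation[OF g e] by metis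
    have "(\<integral>s. g (gleason C s) \<partial>M) \<le> (\<integral>s. cell_function N P r s + e \<partial>M)"
      using cell_function_le(2)[OF g f(1) _ f(4)] int integral_cell_function(1)[OF f(1)]
      by (intro integral_mono) (auto simp: space_stone_measure topspace_stone)
    also have "\<dots> = simple_content_integral Y \<BB>\<^sub>h \<mu>\<^sub>h f + e"
      using integral_cell_function(1)[OF f(1)] by (simp add: simple_content_integral_eq[OF f(1)] prob_space)
    also have "simple_content_integral Y \<BB>\<^sub>h \<mu>\<^sub>h f \<le> v"
      using f by (intro ub) (auto simp: bounded_simple_def)
    finally show "(\<integral>s. g (gleason C s) \<partial>M) \<le> v + e" by simp
  qed
qed

section \<open>The two integration spaces and the Gleason morphism\<close>

lemma comeasurable_one: "comeasurable Y \<BB>\<^sub>h (\<lambda>x. 1)"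
  unfolding comeasurable_def
proof (intro conjI allI)
  show "bounded ((\<lambda>x. 1::real) ` topspace Y)"
    by (rule finite_imp_bounded) (auto intro: finite_subset[of _ "{1}"])
  fix r :: real
  have "{x \<in> topspace Y. (1::real) \<le> r} \<in> {{}, topspace Y}" "{x \<in> topspace Y. r \<le> (1::real)} \<in> {{}, topspace Y}"
    by auto
  then show "Y interior_of {x \<in> topspace Y. (1::real) \<le> r} \<in> \<BB>\<^sub>h"
    "Y interior_of {x \<in> topspace Y. r \<le> (1::real)} \<in> \<BB>\<^sub>h"
    using hat_alg_empty hat_alg_topspace by (metis interior_of_empty interior_of_topspace insertE singletonD)+
qed simp

lemma itg_simps:
  "itg_top (Xi_obj (sigma_obj C)) = S"
  "itg_fns (Xi_obj (sigma_obj C)) = {g. continuous_map S euclideanreal g}"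
  "itg_fun (Xi_obj (sigma_obj C)) = (\<lambda>g. integral\<^sup>L M g)"
  "itg_top (Upsilon_obj (beta_obj C)) = Y"
  "itg_fns (Upsilon_obj (beta_obj C)) = comeasurable_closed_span Y \<BB>\<^sub>h"
  "itg_fun (Upsilon_obj (beta_obj C)) = content_integral Y \<BB>\<^sub>h \<mu>\<^sub>h"
  by (simp_all add: Xi_obj_def sigma_obj_def Upsilon_obj_def beta_obj_def)

lemma integration_space_Xi: "integration_space (Xi_obj (sigma_obj C))"
proof -
  have "integration_space \<lparr>itg_top = S, itg_fns = {g. continuous_map S euclideanreal g}, itg_fun = (\<lambda>g. integral\<^sup>L M g)\<rparr>"
  proof (rule integration_space_of_prob[where p = "\<lambda>s. s" and M = M])
    show "h \<in> {g. continuous_map S euclideanreal g}"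
      if "g \<in> {g. continuous_map S euclideanreal g}" "\<And>x. x \<in> topspace S \<Longrightarrow> h x = g x" for g h
      using that continuous_map_eq[of S euclideanreal g h] by auto
  qed (auto simp: compact_imp_locally_compact_space compact_space_stone Hausdorff_space_stone
      prob_space_axioms space_stone_measure integrable_continuous
      intro: continuous_map_add continuous_map_real_mult)
  then show ?thesis by (simp add: Xi_obj_def sigma_obj_def)
qed

lemma integration_space_Upsilon: "integration_space (Upsilon_obj (beta_obj C))"
proof -
  have c: "continuous_map Y euclideanreal g" if "g \<in> comeasurable_closed_span Y \<BB>\<^sub>h" for g
    using that by (simp add: comeasurable_closed_span_def)
  have "integration_space \<lparr>itg_top = Y, itg_fns = comeasurable_closed_span Y \<BB>\<^sub>h,
      itg_fun = content_integral Y \<BB>\<^sub>h \<mu>\<^sub>h\<rparr>"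
    by (rule integration_space_of_prob[where p = "gleason C" and M = M])
      (auto simp: compact_imp_locally_compact_space compact_space_stone_cech Hausdorff_space_stone_cech
        prob_space_axioms space_stone_measure topspace_stone gleason_topspace c
        integrable_comp_gleason content_integral_eq
        intro: comeasurable_closed_span_add comeasurable_closed_span_mult comeasurable_closed_span_cong
          comeasurable_subset_closed_span comeasurable_one)
  then show ?thesis by (simp add: Upsilon_obj_def beta_obj_def)
qed

lemma gleason_integration_morphism:
  "integration_morphism (Xi_obj (sigma_obj C)) (Upsilon_obj (beta_obj C)) (gleason C)"
  unfolding integration_morphism_def itg_simps
proof (intro conjI ballI integration_space_Xi integration_space_Upsilon continuous_map_gleason)
  fix g assume "g \<in> comeasurable_closed_span Y \<BB>\<^sub>h"
  then have g: "continuous_map Y euclideanreal g" by (simp add: comeasurable_closed_span_def)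
  show "g \<circ> gleason C \<in> {g. continuous_map S euclideanreal g}"
    using continuous_map_compose[OF continuous_map_gleason g] by simp
  show "integral\<^sup>L M (g \<circ> gleason C) = content_integral Y \<BB>\<^sub>h \<mu>\<^sub>h g"
    by (simp add: content_integral_eq[OF g] comp_def)
qed

lemma gleason_CmpInt_morphism:
  "CmpInt_morphism (Xi_obj (sigma_obj C)) (Upsilon_obj (beta_obj C)) (gleason C)"
  by (simp add: CmpInt_morphism_def gleason_integration_morphism itg_simps compact_space_stone
      compact_space_stone_cech)

end

section \<open>Naturality\<close>

text \<open>Inverse images preserve intersections, inclusions, the empty set and the whole space by
  set theory and totality of \<open>\<phi>\<close>. The homomorphism condition supplies membership
  in the algebra and compatibility with regular complements.\<close>

lemma ultrafilter_of_sigma_arr: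
  assumes \<phi>: "content_morphism C1 C2 \<phi>" and s: "ultrafilter_of (cont_top C1) (cont_alg C1) s"
  shows "ultrafilter_of (cont_top C2) (cont_alg C2) (sigma_arr C1 C2 \<phi> s)"
proof -
  let ?X1 = "cont_top C1" and ?X2 = "cont_top C2" and ?B1 = "cont_alg C1" and ?B2 = "cont_alg C2"
  let ?h = "inverse_image ?X1 \<phi>"
  interpret C1: content_sp C1 using \<phi> by unfold_locales (simp add: content_morphism_def)
  interpret C2: content_sp C2 using \<phi> by unfold_locales (simp add: content_morphism_def)
  have cont: "continuous_map ?X1 ?X2 \<phi>" using \<phi> by (simp add: content_morphism_def)
  have hom: "boolean_hom ?X2 ?B2 ?X1 ?B1 ?h" using \<phi> by (simp add: content_morphism_def)
  have h: "?h Q \<in> ?B1" "?h (regular_neg ?X2 Q) = regular_neg ?X1 (?h Q)" if "Q \<in> ?B2" for Q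
    using hom that by (auto simp: boolean_hom_def)
  have top: "?h (topspace ?X2) = topspace ?X1"
    using cont by (auto simp: inverse_image_def continuous_map_def)
  have Int: "?h (Q \<inter> R) = ?h Q \<inter> ?h R" for Q R by (auto simp: inverse_image_def)
  have mono: "?h Q \<subseteq> ?h R" if "Q \<subseteq> R" for Q R using that by (auto simp: inverse_image_def)
  have empty: "?h {} = {}" by (auto simp: inverse_image_def)
  note D = ultrafilter_ofD[OF s]
  show ?thesis
    unfolding ultrafilter_of_def sigma_arr_def
  proof (intro conjI ballI impI)
    show "topspace ?X2 \<in> {B \<in> ?B2. ?h B \<in> s}" using top D(2) by simp
    show "{} \<notin> {B \<in> ?B2. ?h B \<in> s}" using empty D(3) by simp
    show "R \<in> {B \<in> ?B2. ?h B \<in> s} \<or> regular_neg ?X2 R \<in> {B \<in> ?B2. ?h B \<in> s}" if R: "R \<in> ?B2" for R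
      using h[OF R] D(6)[of "?h R"] R by auto
  qed (use D(4,5) h(1) mono in \<open>auto simp: Int\<close>)
qed

text \<open>By \<open>gleason_eqI\<close> it is enough that the left side lies in the closure of the
  hat of every \<open>B\<close> in the image ultrafilter.\<close>

lemma gleason_natural:
  assumes \<phi>: "content_morphism C1 C2 \<phi>" and s: "ultrafilter_of (cont_top C1) (cont_alg C1) s"
  shows "beta_arr C1 C2 \<phi> (gleason C1 s) = gleason C2 (sigma_arr C1 C2 \<phi> s)"
proof -
  let ?X1 = "cont_top C1" and ?X2 = "cont_top C2"
  let ?Y1 = "stone_cech ?X1" and ?Y2 = "stone_cech ?X2"
  interpret C1: content_sp C1 using \<phi> by unfold_locales (simp add: content_morphism_def)
  interpret C2: content_sp C2 using \<phi> by unfold_locales (simp add: content_morphism_def)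
  have cont: "continuous_map ?X1 ?X2 \<phi>" using \<phi> by (simp add: content_morphism_def)
  let ?\<psi> = "sc_extend ?X1 ?X2 \<phi>"
  have "?\<psi> (gleason C1 s) \<in> ?Y2 closure_of (sc_hat ?X2 B)" if B: "B \<in> sigma_arr C1 C2 \<phi> s" for B
  proof -
    let ?A = "inverse_image ?X1 \<phi> B"
    have A: "?A \<in> s" "B \<in> cont_alg C2" using B by (auto simp: sigma_arr_def)
    have AB: "?A \<in> cont_alg C1" using ultrafilter_ofD(1)[OF s A(1)] .
    \<comment> \<open>The closure is rewritten over embedded points, since there the extension is
      given by \<open>\<phi>\<close>.\<close>
    have "gleason C1 s \<in> ?Y1 closure_of (sc_embed ?X1 ` ?A)"
      using C1.gleason_mem[OF s A(1)] closure_of_sc_hat[OF C1.completely_regular C1.regular[OF AB]] by simp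
    then have "?\<psi> (gleason C1 s) \<in> ?Y2 closure_of (?\<psi> ` sc_embed ?X1 ` ?A)"
      using continuous_map_image_closure_subset[OF sc_extend_spec(1)[OF cont]] by blast
    moreover have "?\<psi> ` sc_embed ?X1 ` ?A \<subseteq> sc_embed ?X2 ` B"
      using sc_extend_spec(2)[OF cont] by (auto simp: inverse_image_def)
    ultimately have "?\<psi> (gleason C1 s) \<in> ?Y2 closure_of (sc_embed ?X2 ` B)"
      using closure_of_mono by blast
    then show ?thesis
      using closure_of_sc_hat[OF C2.completely_regular C2.regular[OF A(2)]] by simp
  qed
  then show ?thesis
    unfolding beta_arr_def
    by (intro C2.gleason_eqI[OF ultrafilter_of_sigma_arr[OF \<phi> s], symmetric])
qed

text \<open>Naturality is stated at the points of the Stone space, the domain on which these maps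
  carry meaning; the two \<open>CmpInt_morphism\<close> clauses say that the components are arrows
  of the target category.\<close>

theorem proposition9p4:
  fixes C :: "'a content_triple"
    and C1 :: "'b content_triple" and C2 :: "'c content_triple" and \<phi> :: "'b \<Rightarrow> 'c"
  shows "(content_space C \<longrightarrow>
            integration_morphism (Xi_obj (sigma_obj C)) (Upsilon_obj (beta_obj C)) (gleason C)) \<and>
         (content_morphism C1 C2 \<phi> \<longrightarrow>
            CmpInt_morphism (Xi_obj (sigma_obj C1)) (Upsilon_obj (beta_obj C1)) (gleason C1) \<and>
            CmpInt_morphism (Xi_obj (sigma_obj C2)) (Upsilon_obj (beta_obj C2)) (gleason C2) \<and>
            (\<forall>s\<in>topspace (itg_top (Xi_obj (sigma_obj C1))).
               (beta_arr C1 C2 \<phi> \<circ> gleason C1) s = (gleason C2 \<circ> sigma_arr C1 C2 \<phi>) s))"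
proof (intro conjI impI ballI)
  assume "content_space C"
  then interpret content_sp C by unfold_locales
  show "integration_morphism (Xi_obj (sigma_obj C)) (Upsilon_obj (beta_obj C)) (gleason C)"
    by (rule gleason_integration_morphism)
next
  assume \<phi>: "content_morphism C1 C2 \<phi>"
  interpret C1: content_sp C1 using \<phi> by unfold_locales (simp add: content_morphism_def)
  interpret C2: content_sp C2 using \<phi> by unfold_locales (simp add: content_morphism_def)
  show "CmpInt_morphism (Xi_obj (sigma_obj C1)) (Upsilon_obj (beta_obj C1)) (gleason C1)"
    by (rule C1.gleason_CmpInt_morphism)
  show "CmpInt_morphism (Xi_obj (sigma_obj C2)) (Upsilon_obj (beta_obj C2)) (gleason C2)"
    by (rule C2.gleason_CmpInt_morphism)
  fix s assume "s \<in> topspace (itg_top (Xi_obj (sigma_obj C1)))"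
  then have "ultrafilter_of (cont_top C1) (cont_alg C1) s"
    by (simp add: C1.itg_simps C1.topspace_stone)
  then show "(beta_arr C1 C2 \<phi> \<circ> gleason C1) s = (gleason C2 \<circ> sigma_arr C1 C2 \<phi>) s"
    using gleason_natural[OF \<phi>] by simp
qed

end
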